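(* Let $\{\gamma_n\}_{n=1}^\infty$ be a decreasing (i.e. $\gamma_n\ge\gamma_{n+1}$) sequence of positive numbers such that for some $\delta>0$ $$\gamma_n=O\big(\gamma_{[n^{1+\delta}]}\big)\quad\text{as } n\to\infty,\qquad\text{and}\qquad \sum_{n=1}^\infty\frac{\gamma_n}{n}=\infty,$$ where $[\cdot]$ denotes the integer part. Let $\Lambda=\{\lambda_n\}$ with $\lambda_n=n\gamma_n$. Then there exists a continuous function $f\in P\Lambda BV$ ($2\pi$-periodic in each variable) whose Fourier series diverges at $(0,0)$, i.e. the rectangular partial sums $S_{M,N}[f,(0,0)]$ do not converge as $\min(M,N)\to\infty$.
   Context: $T=[0,2\pi]$, $T^2=[0,2\pi]^2$; functions $f$ are real functions of two variables, $2\pi$-periodic in each variable. For intervals $I=(a,b)\subset T$, $J=(c,d)\subset T$ and $x,y\in T$: $f(I,y)=f(b,y)-f(a,y)$ and $f(x,J)=f(x,d)-f(x,c)$. Let $\Omega$ be the set of all collections $E=\{I_i\}$ of nonoverlapping intervals in $T$, ordered in an arbitrary way. For a sequence of positive numbers $\Lambda=\{\lambda_n\}$, $$\Lambda V_1(f)=\sup_{y}\sup_{E=\{I_i\}\in\Omega}\sum_i\frac{|f(I_i,y)|}{\lambda_i},\qquad \Lambda V_2(f)=\sup_{x}\sup_{F=\{J_j\}\in\Omega}\sum_j\frac{|f(x,J_j)|}{\lambda_j}.$$ $f\in P\Lambda BV$ (bounded partial $\Lambda$-variation) means $\Lambda V_1(f)+\Lambda V_2(f)<\infty$. For $f\in L^1(T^2)$,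 $\widehat f(m,n)=\frac1{4\pi^2}\int_0^{2\pi}\int_0^{2\pi}f(x,y)e^{-imx}e^{-iny}\,dx\,dy$, and the rectangular partial sums of the Fourier series are $S_{M,N}[f,(x,y)]=\sum_{m=-M}^{M}\sum_{n=-N}^{N}\widehat f(m,n)e^{imx}e^{iny}$. Convergence of the double Fourier series is understood in the sense of Pringsheim (as $\min(M,N)\to\infty$). *)

theory Defs
  imports "HOL-Analysis.Analysis" "HOL-Library.Landau_Symbols"
begin

text \<open>
  A collection of intervals in \<open>[0, 2\<pi>]\<close> "ordered in an arbitrary way" is an enumeration
  \<open>I\<close> of pairs of endpoints \<open>(a, b)\<close>, indexed by \<open>K = {1..k}\<close> (finite, possibly empty) or by
  \<open>K = {1..}\<close> (countably infinite). Intervals are nondegenerate, and nonoverlapping means that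
  their interiors are disjoint.
\<close>

definition interval_collections :: "(nat set \<times> (nat \<Rightarrow> real \<times> real)) set" where
  "interval_collections = {(K, I).
     (K = {1..} \<or> (\<exists>k. K = {1..k})) \<and>
     (\<forall>i\<in>K. 0 \<le> fst (I i) \<and> fst (I i) < snd (I i) \<and> snd (I i) \<le> 2 * pi) \<and>
     disjoint_family_on (\<lambda>i. {fst (I i)<..<snd (I i)}) K}"

definition incr1 :: "(real \<Rightarrow> real \<Rightarrow> real) \<Rightarrow> real \<times> real \<Rightarrow> real \<Rightarrow> real" where
  "incr1 f I y = f (snd I) y - f (fst I) y"

definition incr2 :: "(real \<Rightarrow> real \<Rightarrow> real) \<Rightarrow> real \<Rightarrow> real \<times> real \<Rightarrow> real" where
  "incr2 f x J = f x (snd J) - f x (fst J)"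

text \<open>
  The variations take values in \<open>[0, \<infinity>]\<close>. Only the values \<open>\<Lambda> i\<close> with \<open>i \<ge> 1\<close> are used; they
  are meant to be positive.
\<close>

definition Lambda_V1 :: "(nat \<Rightarrow> real) \<Rightarrow> (real \<Rightarrow> real \<Rightarrow> real) \<Rightarrow> ennreal" where
  "Lambda_V1 \<Lambda> f = (SUP y\<in>{0..2*pi}. SUP (K, I)\<in>interval_collections.
     \<Sum>\<^sub>\<infinity>i\<in>K. ennreal (\<bar>incr1 f (I i) y\<bar> / \<Lambda> i))"

definition Lambda_V2 :: "(nat \<Rightarrow> real) \<Rightarrow> (real \<Rightarrow> real \<Rightarrow> real) \<Rightarrow> ennreal" where
  "Lambda_V2 \<Lambda> f = (SUP x\<in>{0..2*pi}. SUP (K, J)\<in>interval_collections.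
     \<Sum>\<^sub>\<infinity>j\<in>K. ennreal (\<bar>incr2 f x (J j)\<bar> / \<Lambda> j))"

definition doubly_periodic :: "(real \<Rightarrow> real \<Rightarrow> real) \<Rightarrow> bool" where
  "doubly_periodic f \<longleftrightarrow> (\<forall>x y. f (x + 2 * pi) y = f x y \<and> f x (y + 2 * pi) = f x y)"

definition PLambdaBV :: "(nat \<Rightarrow> real) \<Rightarrow> (real \<Rightarrow> real \<Rightarrow> real) set" where
  "PLambdaBV \<Lambda> = {f. doubly_periodic f \<and> Lambda_V1 \<Lambda> f + Lambda_V2 \<Lambda> f < \<infinity>}"

definition fourier_coeff :: "(real \<Rightarrow> real \<Rightarrow> real) \<Rightarrow> int \<Rightarrow> int \<Rightarrow> complex" where
  "fourier_coeff f m n = 1 / (4 * of_real pi ^ 2) *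
     (LINT y:{0..2*pi}|lborel. LINT x:{0..2*pi}|lborel.
        of_real (f x y) * exp (- \<i> * of_int m * of_real x) * exp (- \<i> * of_int n * of_real y))"

definition fourier_partial_sum ::
    "nat \<Rightarrow> nat \<Rightarrow> (real \<Rightarrow> real \<Rightarrow> real) \<Rightarrow> real \<times> real \<Rightarrow> complex" where
  "fourier_partial_sum M N f p = (\<Sum>m\<in>{- int M..int M}. \<Sum>n\<in>{- int N..int N}.
     fourier_coeff f m n * exp (\<i> * of_int m * of_real (fst p)) * exp (\<i> * of_int n * of_real (snd p)))"

text \<open>
  Pringsheim convergence: \<open>min M N \<rightarrow> \<infinity>\<close> is the product filter of \<^const>\<open>sequentially\<close> with itself.
\<close>

definition fourier_converges_at :: "(real \<Rightarrow> real \<Rightarrow> real) \<Rightarrow> real \<times> real \<Rightarrow> bool" where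
  "fourier_converges_at f p \<longleftrightarrow>
     (\<exists>L. ((\<lambda>(M, N). fourier_partial_sum M N f p) \<longlongrightarrow> L) (sequentially \<times>\<^sub>F sequentially))"

end

theory Submission
  imports Defs "HOL-Real_Asymp.Real_Asymp"
begin

text \<open>
  Choose \<open>q\<^sub>0\<close> large and \<open>q\<^sub>k\<^sub>+\<^sub>1 = [q\<^sub>k ^ (1 + \<delta>)]\<close>; on each block
  \<open>[q\<^sub>k, q\<^sub>k\<^sub>+\<^sub>1)\<close> the sequence \<open>\<gamma>\<close> varies by at most a constant factor, so the divergence of
  \<open>\<Sum> \<gamma> n / n\<close> means that of \<open>\<Sum> \<gamma>(q\<^sub>k) ln q\<^sub>k\<close>. For \<open>N = q\<^sub>K\<close> and \<open>h = \<pi> / (N + 1/2)\<close> let \<open>P\<^sub>k\<close> be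
  \<open>sin ((N + 1/2) x)\<close> cut off to \<open>[q\<^sub>k h, q\<^sub>k\<^sub>+\<^sub>1 h]\<close>, and consider
  \<open>G\<^sub>K(x, y) = \<Sum>k<K. \<gamma>(q\<^sub>k) / ln q\<^sub>k * P\<^sub>k(x) * P\<^sub>k(y)\<close>. Since the \<open>P\<^sub>k\<close> have disjoint supports, each
  section of \<open>G\<^sub>K\<close> is one wave with about \<open>q\<^sub>k\<^sub>+\<^sub>1\<close> oscillations, whose \<open>\<Lambda>\<close>-variation
  \<open>O(ln q\<^sub>k / \<gamma>(q\<^sub>k))\<close> is offset by the amplitude; hence the \<open>G\<^sub>K\<close> have uniformly bounded partial variation.
  On the other hand the integral of \<open>P\<^sub>k\<close> against the Dirichlet kernel is of order
  \<open>ln (q\<^sub>k\<^sub>+\<^sub>1 / q\<^sub>k)\<close>, so \<open>S\<^sub>N\<^sub>,\<^sub>N[G\<^sub>K, (0,0)]\<close> is of order at least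
  \<open>\<Sum>k<K. \<gamma>(q\<^sub>k) ln q\<^sub>k\<close>, which is unbounded. A gliding hump yields a single function.
\<close>

section \<open>Gliding hump, for use in the Banach space of bounded continuous functions\<close>

instance bcontfun :: (metric_space, banach) banach ..

lemma bounded_linear_apply_bcontfun: "bounded_linear (\<lambda>\<phi> :: 'a::topological_space \<Rightarrow>\<^sub>C real. apply_bcontfun \<phi> p)"
proof (rule bounded_linear_intro[where K = 1])
  show "norm (apply_bcontfun \<phi> p) \<le> norm \<phi> * 1" for \<phi> :: "'a \<Rightarrow>\<^sub>C real"
    using norm_bounded[of \<phi> p] by simp
qed simp_all

text \<open>Compared with plain uniform boundedness, the witness is an explicit series in the
  \<open>g n\<close> with summable nonnegative coefficients. Any seminorm that is uniformly bounded
  on the \<open>g n\<close> and passes to limits, here the \<Lambda>-variation, therefore stays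
  finite on it.\<close>

lemma gliding_hump:
  fixes T :: "nat \<Rightarrow> 'a::banach \<Rightarrow> 'b::real_normed_vector" and g :: "nat \<Rightarrow> 'a"
  assumes lin: "\<And>n. bounded_linear (T n)"
    and bd: "\<And>n. norm (g n) \<le> B"
    and unbdd: "\<And>R. \<exists>n. norm (T n (g n)) > R"
  obtains s m where "\<And>k::nat. 0 \<le> (s k :: real)" "summable s"
    "\<And>R. \<exists>n. norm (T n (\<Sum>k. s k *\<^sub>R g (m k))) > R"
proof -
  have "\<forall>n. \<exists>C>0. \<forall>x. norm (T n x) \<le> norm x * C"
    using bounded_linear.pos_bounded[OF lin] by blast
  then obtain C where C0: "\<And>n. C n > 0" and C: "\<And>n x. norm (T n x) \<le> norm x * C n"
    by metis
  have B0: "0 \<le> B" using bd[of 0] norm_ge_zero order_trans by blast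
  \<comment> \<open>A state \<open>(e, h, n, s)\<close> holds a cap \<open>e\<close> on the current
    coefficient \<open>s\<close>, the partial sum \<open>h\<close>, and the index \<open>n\<close>
    of a functional already large at \<open>h\<close>. The clause at \<open>k = 0\<close> makes the
    recursion start from the empty sum.\<close>
  define P where "P = (\<lambda>(k::nat) (e::real, h, n, s::real). 0 < e \<and> 0 \<le> s \<and> s \<le> e \<and> real k \<le> norm (T n h) \<and> (k = 0 \<longrightarrow> h = 0))"
  define Q where "Q = (\<lambda>(k::nat) (e::real, h::'a, n::nat, s::real) (e'::real, h', n', s').
     e' \<le> e / 2 \<and> e' * C n \<le> 1 \<and> h' = h + s' *\<^sub>R g n')"
  have "\<exists>st. \<forall>k. P k (st k) \<and> Q k (st k) (st (Suc k))"
  proof (rule dependent_nat_choice[where P=P and Q=Q])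
    show "\<exists>x. P 0 x"
      by (rule exI[of _ "(1, 0, 0, 0)"]) (simp add: P_def)
  next
    fix x k assume Px: "P k x"
    obtain e h n s where x: "x = (e, h, n, s)" by (metis prod_cases4)
    have e: "0 < e" using Px by (simp add: P_def x)
    \<comment> \<open>Halving makes the later coefficients decay geometrically; the cap
      \<open>1 / C n\<close> keeps all later terms together from changing \<open>T n\<close> by more
      than \<open>2 * B\<close>.\<close>
    define e' where "e' = min (e / 2) (1 / C n)"
    have e'0: "0 < e'" using e C0[of n] by (simp add: e'_def)
    have e': "e' \<le> e / 2" "e' * C n \<le> 1"
      using C0[of n] by (auto simp: e'_def min_def field_simps)
    \<comment> \<open>The factor 2 is for the triangle inequality: of two values differing by at
      least \<open>2 * Suc k\<close> in norm, one has norm at least \<open>Suc k\<close>.\<close>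
    obtain n' where n': "norm (T n' (g n')) > 2 * real (Suc k) / e'" using unbdd by blast
    interpret bounded_linear "T n'" by (rule lin)
    have "2 * real (Suc k) \<le> e' * norm (T n' (g n'))"
      using n' e'0 by (simp add: field_simps)
    also have "\<dots> = norm (T n' (h + e' *\<^sub>R g n') - T n' h)"
      using e'0 by (simp add: add scaleR)
    also have "\<dots> \<le> norm (T n' (h + e' *\<^sub>R g n')) + norm (T n' h)"
      by (rule norm_triangle_ineq4)
    finally have "real (Suc k) \<le> norm (T n' (h + e' *\<^sub>R g n')) \<or> real (Suc k) \<le> norm (T n' (h + 0 *\<^sub>R g n'))"
      by auto
    \<comment> \<open>Taking or omitting the bump, whichever makes the functional large, spares any control of the earlier terms.\<close>
    then obtain s' where s': "s' = e' \<or> s' = 0" "real (Suc k) \<le> norm (T n' (h + s' *\<^sub>R g n'))"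
      by metis
    show "\<exists>y. P (Suc k) y \<and> Q k x y"
      using s' e' e'0 by (intro exI[of _ "(e', h + s' *\<^sub>R g n', n', s')"]) (auto simp: P_def Q_def x)
  qed
  then obtain st where st: "\<And>k. P k (st k)" "\<And>k. Q k (st k) (st (Suc k))" by blast
  define e where "e k = fst (st k)" for k
  define h where "h k = fst (snd (st k))" for k
  define n where "n k = fst (snd (snd (st k)))" for k
  define s where "s k = snd (snd (snd (st k)))" for k
  have st_eq: "st k = (e k, h k, n k, s k)" for k
    by (simp add: e_def h_def n_def s_def)
  have e0: "0 < e k" and s0: "0 \<le> s k" and se: "s k \<le> e k" and Th: "real k \<le> norm (T (n k) (h k))" for k
    using st(1)[of k] by (auto simp: st_eq P_def)
  have e2: "e (Suc k) \<le> e k / 2" and eC: "e (Suc k) * C (n k) \<le> 1" 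
    and hS: "h (Suc k) = h k + s (Suc k) *\<^sub>R g (n (Suc k))" for k
    using st(2)[of k] by (auto simp: st_eq Q_def)
  have h0: "h 0 = 0" using st(1)[of 0] by (simp add: st_eq P_def)
  have epow: "e (k + i) \<le> e k * (1/2) ^ i" for k i
  proof (induction i)
    case (Suc i)
    have "e (k + Suc i) \<le> e (k + i) / 2" using e2[of "k + i"] by simp
    also have "\<dots> \<le> e k * (1/2) ^ i / 2" using Suc by simp
    finally show ?case by simp
  qed simp
  have geo: "summable (\<lambda>i. (1/2::real) ^ i)" by (rule summable_geometric) simp
  define a where "a k = s (Suc k) *\<^sub>R g (n (Suc k))" for k
  have na: "norm (a (k + i)) \<le> e (Suc k) * B * (1/2) ^ i" for k i
  proof -
    have "norm (a (k + i)) \<le> s (Suc k + i) * B"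
      unfolding a_def using s0 bd by (simp add: mult_left_mono)
    also have "\<dots> \<le> (e (Suc k) * (1/2) ^ i) * B"
      using order_trans[OF se epow] B0 by (rule mult_right_mono)
    finally show ?thesis by (simp add: mult_ac)
  qed
  have geo': "summable (\<lambda>i. e (Suc k) * B * (1/2) ^ i)" for k
    by (rule summable_mult[OF geo])
  have sa': "summable (\<lambda>i. a (k + i))" for k
    by (rule summable_comparison_test'[OF geo'[of k], of 0]) (rule na)
  have sa: "summable a" using sa'[of 0] by simp
  have hsum: "h k = (\<Sum>i<k. a i)" for k
    by (induction k) (simp_all add: hS a_def h0)
  have ss: "summable (\<lambda>k. s (Suc k))"
    by (rule summable_comparison_test'[OF summable_mult[OF geo, of "e (Suc 0)"], of 0])
       (use s0 order_trans[OF se epow[of "Suc 0"]] in auto)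
  define f where "f = (\<Sum>k. a k)"
  \<comment> \<open>The tail after stage \<open>k\<close> has norm at most
    \<open>2 * B * e (Suc k)\<close>, and \<open>e (Suc k)\<close> was capped against
    \<open>C (n k)\<close>.\<close>
  have Tf: "real k - 2 * B \<le> norm (T (n k) f)" for k
  proof -
    interpret bounded_linear "T (n k)" by (rule lin)
    define r where "r = (\<Sum>i. a (k + i))"
    have fr: "f = h k + r"
      unfolding f_def r_def using suminf_split_initial_segment[OF sa, of k] 
      by (simp add: hsum add.commute)
    have "norm r \<le> (\<Sum>i. e (Suc k) * B * (1/2) ^ i)"
      unfolding r_def by (rule norm_suminf_le) (use na geo' in auto)
    also have "\<dots> = e (Suc k) * B * 2"
      using suminf_mult[OF geo, of "e (Suc k) * B"] suminf_geometric[of "1/2::real"] by simp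
    finally have nr: "norm r \<le> e (Suc k) * B * 2" .
    have "norm (T (n k) r) \<le> norm r * C (n k)" by (rule C)
    also have "\<dots> \<le> (e (Suc k) * B * 2) * C (n k)"
      using nr C0[of "n k"] by (intro mult_right_mono) auto
    also have "\<dots> = (e (Suc k) * C (n k)) * (2 * B)" by simp
    also have "\<dots> \<le> 1 * (2 * B)" using eC B0 by (intro mult_right_mono) auto
    finally have Tr: "norm (T (n k) r) \<le> 2 * B" by simp
    have "T (n k) (h k) = T (n k) f - T (n k) r"
      by (simp add: fr add)
    then have "norm (T (n k) (h k)) \<le> norm (T (n k) f) + norm (T (n k) r)"
      by (metis norm_triangle_ineq4)
    then show ?thesis using Th[of k] Tr by simp
  qed
  show ?thesis
  \<comment> \<open>The initial state carries no summand, hence the shift by one.\<close>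
  proof (rule that[of "\<lambda>k. s (Suc k)" "\<lambda>k. n (Suc k)"])
    fix R
    obtain k where "real k > R + 2 * B" using reals_Archimedean2 by blast
    then have "norm (T (n k) f) > R" using Tf[of k] by simp
    then show "\<exists>n'. R < norm (T n' (\<Sum>k. s (Suc k) *\<^sub>R g (n (Suc k))))"
      unfolding f_def a_def by blast
  qed (use s0 ss in auto)
qed

subsection \<open>Square partial sums at the origin\<close>

text \<open>The kernel \<open>sin ((N + 1/2) x) / sin (x / 2)\<close>, as a cosine sum so that it is
  continuous also at the multiples of \<open>2 * \<pi>\<close>.\<close>

definition dirichlet_kernel :: "nat \<Rightarrow> real \<Rightarrow> real" where
  "dirichlet_kernel N x = 1 + 2 * (\<Sum>m=1..N. cos (real m * x))"

lemma continuous_on_dirichlet_kernel [continuous_intros]: "continuous_on A (dirichlet_kernel N)"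
  unfolding dirichlet_kernel_def by (intro continuous_intros)

lemma sum_exp_eq_dirichlet_kernel:
  "(\<Sum>m\<in>{- int N..int N}. exp (- \<i> * of_int m * of_real x)) = of_real (dirichlet_kernel N x)"
proof (induction N)
  case (Suc N)
  have "{- int (Suc N)..int (Suc N)} = insert (- int (Suc N)) (insert (int (Suc N)) {- int N..int N})"
    by auto
  then have "(\<Sum>m\<in>{- int (Suc N)..int (Suc N)}. exp (- \<i> * of_int m * of_real x)) =
     exp (\<i> * of_real (real (Suc N) * x)) + exp (- (\<i> * of_real (real (Suc N) * x))) + of_real (dirichlet_kernel N x)"
    by (simp add: Suc[symmetric] algebra_simps)
  also have "exp (\<i> * of_real (real (Suc N) * x)) + exp (- (\<i> * of_real (real (Suc N) * x)))
      = 2 * cos (of_real (real (Suc N) * x))"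
    unfolding cos_exp_eq by simp
  also have "\<dots> + of_real (dirichlet_kernel N x) = of_real (dirichlet_kernel (Suc N) x)"
    by (simp add: dirichlet_kernel_def flip: cos_of_real)
  finally show ?case .
qed (simp add: dirichlet_kernel_def)

lemma sin_half_times_dirichlet_kernel:
  "sin (x / 2) * dirichlet_kernel N x = sin ((real N + 1 / 2) * x)"
proof (induction N)
  case (Suc N)
  have "sin ((real (Suc N) + 1 / 2) * x) = sin (real (Suc N) * x + x / 2)"
    and "sin ((real N + 1 / 2) * x) = sin (real (Suc N) * x - x / 2)"
    by (simp_all add: algebra_simps)
  with Suc show ?case
    unfolding sin_add sin_diff by (simp add: dirichlet_kernel_def algebra_simps)
qed (simp add: dirichlet_kernel_def)

lemma LINT_interval_eq_integral:
  fixes f :: "real \<Rightarrow> complex"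
  assumes "continuous_on {a..b} f"
  shows "(LINT x:{a..b}|lborel. f x) = integral {a..b} f"
  using set_borel_integral_eq_integral(2)[OF borel_integrable_atLeastAtMost'[OF assms]] .

lemma continuous_on_integral_fst:
  fixes h :: "real \<Rightarrow> real \<Rightarrow> complex"
  assumes "continuous_on UNIV (\<lambda>(x, y). h x y)"
  shows "continuous_on A (\<lambda>y. integral {a..b} (\<lambda>x. h x y))"
proof -
  have "continuous_on (A \<times> cbox a b) (\<lambda>p. (\<lambda>(x, y). h x y) (snd p, fst p))"
    by (rule continuous_on_compose2[OF assms]) (auto intro!: continuous_intros)
  then have "continuous_on (A \<times> cbox a b) (\<lambda>(y, x). h x y)"
    by (simp add: case_prod_beta)
  then show ?thesis using integral_continuous_on_param[of A a b "\<lambda>y x. h x y"] by simp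
qed

lemma continuous_on_section:
  assumes "continuous_on UNIV (\<lambda>(x, y). h x y)"
  shows "continuous_on A (\<lambda>x. h x y)"
proof -
  have "continuous_on A (\<lambda>x. (\<lambda>(x, y). h x y) (x, y))"
    by (rule continuous_on_compose2[OF assms]) (auto intro!: continuous_intros)
  then show ?thesis by simp
qed

lemma fourier_coeff_eq_integral:
  assumes "continuous_on UNIV (\<lambda>(x, y). f x y)"
  shows "fourier_coeff f m n = 1 / (4 * of_real pi ^ 2) *
    integral {0..2*pi} (\<lambda>y. integral {0..2*pi} (\<lambda>x.
      of_real (f x y) * exp (- \<i> * of_int m * of_real x) * exp (- \<i> * of_int n * of_real y)))"
proof -
  let ?h = "\<lambda>x y. of_real (f x y) * exp (- \<i> * of_int m * of_real x) * exp (- \<i> * of_int n * of_real y)"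
  have h: "continuous_on UNIV (\<lambda>(x, y). ?h x y)"
    using assms unfolding case_prod_beta by (intro continuous_intros)
  have hx: "continuous_on A (\<lambda>x. ?h x y)" for y A
    using continuous_on_section[OF h] .
  show ?thesis
    unfolding fourier_coeff_def LINT_interval_eq_integral[OF hx]
    by (subst LINT_interval_eq_integral[OF continuous_on_integral_fst[OF h]]) simp
qed

text \<open>Provides the continuity in the sup norm that the gliding hump requires: the exponentials
  have modulus 1, so integration over the square costs at most its area.\<close>

lemma bounded_linear_fourier_coeff:
  "bounded_linear (\<lambda>\<phi> :: (real \<times> real) \<Rightarrow>\<^sub>C real. fourier_coeff (\<lambda>x y. apply_bcontfun \<phi> (x, y)) m n)"
proof -
  define e where "e x y = exp (- \<i> * of_int m * of_real x) * exp (- \<i> * of_int n * of_real y)" for x y :: real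
  have ne: "norm (e x y) = 1" for x y
    unfolding e_def by (simp add: norm_mult)
  define h where "h \<phi> x y = of_real (apply_bcontfun \<phi> (x, y)) * e x y"
    for \<phi> :: "(real \<times> real) \<Rightarrow>\<^sub>C real" and x y
  have h: "continuous_on UNIV (\<lambda>(x, y). h \<phi> x y)" for \<phi>
    unfolding h_def e_def case_prod_beta by (intro continuous_intros) auto
  have hx: "continuous_on A (\<lambda>x. h \<phi> x y)" for y A \<phi>
    using continuous_on_section[OF h] .
  define I where "I \<phi> y = integral {0..2*pi} (\<lambda>x. h \<phi> x y)" for \<phi> y
  have I: "continuous_on A (I \<phi>)" for A \<phi>
    unfolding I_def by (rule continuous_on_integral_fst[OF h])
  have eq: "fourier_coeff (\<lambda>x y. apply_bcontfun \<phi> (x, y)) m n = 1 / (4 * of_real pi ^ 2) * integral {0..2*pi} (I \<phi>)" for \<phi>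
    by (subst fourier_coeff_eq_integral) (auto simp: I_def[abs_def] h_def e_def mult.assoc)
  have int: "f integrable_on {0..2*pi}" if "continuous_on UNIV f" for f :: "real \<Rightarrow> complex"
    by (rule integrable_continuous_interval) (rule continuous_on_subset[OF that], simp)
  have "bounded_linear (\<lambda>\<phi>. integral {0..2*pi} (I \<phi>))"
  proof (rule bounded_linear_intro[where K = "(2 * pi) * (2 * pi)"])
    fix \<phi> \<psi> :: "(real \<times> real) \<Rightarrow>\<^sub>C real" and r :: real
    have "h (\<phi> + \<psi>) x y = h \<phi> x y + h \<psi> x y" for x y
      by (simp add: h_def algebra_simps)
    then have "I (\<phi> + \<psi>) = (\<lambda>y. I \<phi> y + I \<psi> y)"
      unfolding I_def by (simp add: integral_add int hx)
    then show "integral {0..2*pi} (I (\<phi> + \<psi>)) = integral {0..2*pi} (I \<phi>) + integral {0..2*pi} (I \<psi>)"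
      by (simp add: integral_add int I)
    have "h (r *\<^sub>R \<phi>) x y = r *\<^sub>R h \<phi> x y" for x y
      by (simp add: h_def scaleR_conv_of_real)
    then have "I (r *\<^sub>R \<phi>) = (\<lambda>y. r *\<^sub>R I \<phi> y)"
      unfolding I_def by simp
    then show "integral {0..2*pi} (I (r *\<^sub>R \<phi>)) = r *\<^sub>R integral {0..2*pi} (I \<phi>)"
      by simp
    have "norm (h \<phi> x y) \<le> norm \<phi>" for x y
      using norm_bounded[of \<phi> "(x, y)"] by (simp add: h_def norm_mult ne)
    then have "norm (I \<phi> y) \<le> norm \<phi> * (2 * pi)" for y
      unfolding I_def using integral_bound[of 0 "2*pi" "\<lambda>x. h \<phi> x y" "norm \<phi>"] hx by simp
    then show "norm (integral {0..2*pi} (I \<phi>)) \<le> norm \<phi> * ((2 * pi) * (2 * pi))"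
      using integral_bound[of 0 "2*pi" "I \<phi>" "norm \<phi> * (2 * pi)"] I by (simp add: mult.assoc)
  qed
  then show ?thesis unfolding eq by (rule bounded_linear_const_mult)
qed

lemma fourier_partial_sum_origin:
  "fourier_partial_sum M N f (0, 0) = (\<Sum>m\<in>{- int M..int M}. \<Sum>n\<in>{- int N..int N}. fourier_coeff f m n)"
  by (simp add: fourier_partial_sum_def)

lemma bounded_linear_fourier_partial_sum:
  "bounded_linear (\<lambda>\<phi> :: (real \<times> real) \<Rightarrow>\<^sub>C real. fourier_partial_sum M N (\<lambda>x y. apply_bcontfun \<phi> (x, y)) (0, 0))"
  unfolding fourier_partial_sum_origin
  by (intro bounded_linear_sum bounded_linear_fourier_coeff)

lemma fourier_coeff_tensor:
  "fourier_coeff (\<lambda>x y. p x * q y) m n = 1 / (4 * of_real pi ^ 2) *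
     (LINT x:{0..2*pi}|lborel. of_real (p x) * exp (- \<i> * of_int m * of_real x)) *
     (LINT y:{0..2*pi}|lborel. of_real (q y) * exp (- \<i> * of_int n * of_real y))"
proof -
  have "of_real (p x * q y) * exp (- \<i> * of_int m * of_real x) * exp (- \<i> * of_int n * of_real y) =
     (of_real (q y) * exp (- \<i> * of_int n * of_real y)) * (of_real (p x) * exp (- \<i> * of_int m * of_real x))"
    for x y by (simp add: mult_ac)
  then show ?thesis
    unfolding fourier_coeff_def by (simp only: set_integral_mult_right set_integral_mult_left) simp
qed

text \<open>The double sum over a square of frequencies factors into two equal one-dimensional sums.
  The result is a square, so contributions of different tensor products with positive coefficients
  cannot cancel.\<close>

lemma fourier_partial_sum_tensor:
  assumes "continuous_on UNIV p"
  shows "fourier_partial_sum N N (\<lambda>x y. p x * p y) (0, 0) =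
    of_real ((integral {0..2*pi} (\<lambda>x. p x * dirichlet_kernel N x))\<^sup>2 / (4 * pi\<^sup>2))"
proof -
  define a where "a m = (LINT x:{0..2*pi}|lborel. of_real (p x) * exp (- \<i> * of_int m * of_real x))" for m :: int
  have p: "continuous_on A p" for A using assms continuous_on_subset by blast
  have "(\<Sum>m\<in>{- int N..int N}. a m) =
     (\<Sum>m\<in>{- int N..int N}. integral {0..2*pi} (\<lambda>x. of_real (p x) * exp (- \<i> * of_int m * of_real x)))"
    unfolding a_def by (intro sum.cong refl LINT_interval_eq_integral continuous_intros p)
  also have "\<dots> = integral {0..2*pi} (\<lambda>x. \<Sum>m\<in>{- int N..int N}. of_real (p x) * exp (- \<i> * of_int m * of_real x))"
    by (intro integral_sum[symmetric] integrable_continuous_interval continuous_intros p) auto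
  also have "\<dots> = integral {0..2*pi} (\<lambda>x. complex_of_real (p x * dirichlet_kernel N x))"
    by (simp only: sum_distrib_left[symmetric] sum_exp_eq_dirichlet_kernel of_real_mult)
  also have "\<dots> = of_real (integral {0..2*pi} (\<lambda>x. p x * dirichlet_kernel N x))"
    using integral_linear[OF integrable_continuous_interval bounded_linear_of_real[where ?'a = complex],
        of 0 "2 * pi" "\<lambda>x. p x * dirichlet_kernel N x"]
    by (auto simp: o_def intro!: continuous_intros p)
  finally have A: "(\<Sum>m\<in>{- int N..int N}. a m) = of_real (integral {0..2*pi} (\<lambda>x. p x * dirichlet_kernel N x))" .
  have "fourier_partial_sum N N (\<lambda>x y. p x * p y) (0, 0) =
     1 / (4 * of_real pi ^ 2) * ((\<Sum>m\<in>{- int N..int N}. a m) * (\<Sum>m\<in>{- int N..int N}. a m))"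
    unfolding fourier_partial_sum_origin fourier_coeff_tensor a_def[symmetric] sum_product
    by (simp add: sum_distrib_left mult.assoc)
  then show ?thesis unfolding A by (simp add: power2_eq_square)
qed

subsection \<open>Waves cut off to an interval\<close>

text \<open>
  Clamping the \<open>2\<pi>\<close>-periodic triangle wave \<open>arccos (cos x)\<close> gives a continuous periodic function; if
  \<open>sin ((N + 1/2) x)\<close> vanishes at \<open>a\<close> and \<open>b\<close>, applying it yields the cut-off to \<open>[a, b]\<close>, extended evenly.
\<close>

definition wave_block :: "nat \<Rightarrow> real \<Rightarrow> real \<Rightarrow> real \<Rightarrow> real" where
  "wave_block N a b x = sin ((real N + 1 / 2) * max a (min b (arccos (cos x))))"

lemma continuous_on_wave_block [continuous_intros]: "continuous_on A (wave_block N a b)"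
  unfolding wave_block_def by (intro continuous_intros) auto

lemma wave_block_periodic: "wave_block N a b (x + 2 * pi) = wave_block N a b x"
  by (simp add: wave_block_def)

lemma abs_wave_block_le_1: "\<bar>wave_block N a b x\<bar> \<le> 1"
  by (simp add: wave_block_def)

lemma arccos_cos_folded:
  assumes "x \<in> {0..2*pi}"
  shows "arccos (cos x) = min x (2 * pi - x)"
proof (cases "x \<le> pi")
  case True
  then show ?thesis using assms by (simp add: arccos_cos)
next
  case False
  have "arccos (cos (2 * pi - x)) = 2 * pi - x"
    using False assms by (intro arccos_cos) auto
  then show ?thesis using False by (simp add: cos_diff)
qed

text \<open>\<open>(N + 1/2) * 2 * \<pi>\<close> is an odd multiple of \<open>\<pi>\<close>. Hence
  the even extension of a block still agrees with the sine itself on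
  \<open>[\<pi>, 2 * \<pi>]\<close>.\<close>

lemma sin_odd_multiple_reflect: "sin ((real N + 1 / 2) * (2 * pi - x)) = sin ((real N + 1 / 2) * x)"
proof -
  have "(real N + 1 / 2) * (2 * pi - x) = 2 * real N * pi + (pi - (real N + 1 / 2) * x)"
    by (simp add: algebra_simps)
  also have "sin \<dots> = sin (pi - (real N + 1 / 2) * x)"
    by (simp add: sin_add[of "2 * real N * pi"])
  finally show ?thesis by simp
qed

lemma wave_block_eq_0:
  assumes "a \<le> b" "sin ((real N + 1 / 2) * a) = 0" "sin ((real N + 1 / 2) * b) = 0"
    and "arccos (cos x) \<notin> {a<..<b}"
  shows "wave_block N a b x = 0"
proof -
  have "max a (min b (arccos (cos x))) = a \<or> max a (min b (arccos (cos x))) = b"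
    using assms(1,4) by auto
  then show ?thesis using assms(2,3) by (auto simp: wave_block_def)
qed

lemma wave_block_eq:
  assumes "x \<in> {0..2*pi}" "0 \<le> a" "a \<le> b" 
    "sin ((real N + 1 / 2) * a) = 0" "sin ((real N + 1 / 2) * b) = 0"
  shows "wave_block N a b x = (if arccos (cos x) \<in> {a<..<b} then sin ((real N + 1 / 2) * x) else 0)"
proof -
  let ?r = "arccos (cos x)"
  have "sin ((real N + 1 / 2) * ?r) = sin ((real N + 1 / 2) * x)"
    unfolding arccos_cos_folded[OF assms(1)] min_def using sin_odd_multiple_reflect by simp
  then show ?thesis
    using assms by (auto simp: wave_block_def max_def min_def)
qed

text \<open>On the block the integrand is \<open>sin\<^sup>2 (w x) / sin (x / 2)\<close>, which is
  at least \<open>sin\<^sup>2 (w x) / x\<close>; the mean value 1/2 of the squared sine yields half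
  the logarithm. The mirrored half of the period is discarded by nonnegativity.\<close>

lemma wave_block_integral_ge:
  assumes a: "0 < a" "a \<le> b" "b \<le> pi"
    and s: "sin ((real N + 1 / 2) * a) = 0" "sin ((real N + 1 / 2) * b) = 0"
  shows "ln (b / a) / 2 - 1 / (4 * (real N + 1 / 2) * a) \<le>
    integral {0..2*pi} (\<lambda>x. wave_block N a b x * dirichlet_kernel N x)"
proof -
  define w where "w = real N + 1 / 2"
  have w: "w > 0" by (simp add: w_def)
  define g where "g x = wave_block N a b x * dirichlet_kernel N x" for x
  have gc: "continuous_on A g" for A unfolding g_def by (intro continuous_intros)
  have g_eq: "g x = (if arccos (cos x) \<in> {a<..<b} then (sin (w * x))\<^sup>2 / sin (x / 2) else 0)"
    and sx: "0 < sin (x / 2)" if "x \<in> {0<..<2*pi}" for x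
  proof -
    show s0: "0 < sin (x / 2)" using that by (intro sin_gt_zero) auto
    have "dirichlet_kernel N x = sin (w * x) / sin (x / 2)"
      using sin_half_times_dirichlet_kernel[of x N] s0 by (simp add: w_def field_simps)
    then show "g x = (if arccos (cos x) \<in> {a<..<b} then (sin (w * x))\<^sup>2 / sin (x / 2) else 0)"
      unfolding g_def using wave_block_eq[OF _ _ a(2) s, of x] that a
      by (auto simp: w_def power2_eq_square)
  qed
  have g0: "0 \<le> g x" if "x \<in> {0..2*pi}" for x
  proof (cases "x = 0 \<or> x = 2 * pi")
    case True
    then have "wave_block N a b x = 0" using wave_block_eq[OF that _ a(2) s] a by auto
    then show ?thesis by (simp add: g_def)
  next
    case False
    then have x: "x \<in> {0<..<2*pi}" using that by auto
    show ?thesis unfolding g_eq[OF x] using sx[OF x] by simp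
  qed
  \<comment> \<open>\<open>sin\<^sup>2 (w x) / x = (1 - cos (2 w x)) / (2 x)\<close>; integrate the cosine by parts and estimate the remaining
    sine by 1.\<close>
  define F where "F x = ln x / 2 - sin (2 * w * x) / (4 * w * x) + 1 / (4 * w * x)" for x
  define F' where "F' x = 1 / (2 * x) - cos (2 * w * x) / (2 * x) + sin (2 * w * x) / (4 * w * x\<^sup>2) - 1 / (4 * w * x\<^sup>2)" for x
  have "(F' has_integral F b - F a) {a..b}"
  proof (rule fundamental_theorem_of_calculus[OF a(2)])
    fix x assume "x \<in> {a..b}"
    then have x: "x > 0" using a by simp
    show "(F has_vector_derivative F' x) (at x within {a..b})"
      unfolding has_real_derivative_iff_has_vector_derivative[symmetric] F_def F'_def
      using x w by (auto intro!: derivative_eq_intros simp: field_simps power2_eq_square)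
  qed
  moreover have "(g has_integral integral {a..b} g) {a..b}"
    using integrable_continuous_interval[OF gc] by (rule integrable_integral)
  moreover have "F' x \<le> g x" if "x \<in> {a..b}" for x
  proof -
    have x: "x \<in> {0<..<2*pi}" using that a pi_gt_zero by auto
    have "F' x = (1 - cos (2 * w * x)) / (2 * x) + (sin (2 * w * x) - 1) / (4 * w * x\<^sup>2)"
      by (simp add: F'_def diff_divide_distrib)
    also have "\<dots> \<le> (1 - cos (2 * w * x)) / (2 * x)"
      using w by (simp add: divide_nonpos_nonneg)
    also have "\<dots> = (sin (w * x))\<^sup>2 / x"
      using cos_double_sin[of "w * x"] by (simp add: mult.assoc)
    also have "\<dots> \<le> (sin (w * x))\<^sup>2 / sin (x / 2)"
      using sx[OF x] sin_x_le_x[of "x / 2"] x by (intro divide_left_mono) auto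
    also have "\<dots> = g x"
    proof -
      have "arccos (cos x) = x" using that a by (intro arccos_cos) auto
      then show ?thesis unfolding g_eq[OF x] using that s by (auto simp: w_def)
    qed
    finally show ?thesis .
  qed
  ultimately have "F b - F a \<le> integral {a..b} g"
    by (rule has_integral_le)
  also have "\<dots> \<le> integral {0..2*pi} g"
    using a pi_gt_zero g0 by (intro integral_subset_le integrable_continuous_interval gc) auto
  finally have "F b - F a \<le> integral {0..2*pi} g" .
  \<comment> \<open>The oscillating boundary terms vanish at the zeros \<open>a\<close> and
    \<open>b\<close>; of the two remaining error terms the one at \<open>b\<close> has a favourable
    sign and is dropped.\<close>
  moreover have "sin (2 * w * a) = 0" "sin (2 * w * b) = 0"
    using s[folded w_def] sin_double[of "w * a"] sin_double[of "w * b"] by (simp_all add: mult.assoc)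
  then have "F b - F a = ln (b / a) / 2 + 1 / (4 * w * b) - 1 / (4 * w * a)"
    using a by (simp add: F_def ln_div diff_divide_distrib)
  moreover have "0 \<le> 1 / (4 * w * b)" using a w by simp
  ultimately show ?thesis unfolding g_def w_def by linarith
qed

text \<open>The intervals come in arbitrary order, so instead of sorting and telescoping, the
  increments are read as lengths of disjoint intervals inside
  \<open>[\<theta> A, \<theta> B]\<close> and compared by measure.\<close>

lemma sum_mono_increments_le:
  fixes \<theta> :: "real \<Rightarrow> real"
  assumes "finite F" and mono: "\<And>x y. x \<le> y \<Longrightarrow> \<theta> x \<le> \<theta> y"
    and I: "\<And>i. i \<in> F \<Longrightarrow> A \<le> fst (I i) \<and> fst (I i) < snd (I i) \<and> snd (I i) \<le> B" "A \<le> B"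
    and disj: "disjoint_family_on (\<lambda>i. {fst (I i)<..<snd (I i)}) F"
  shows "(\<Sum>i\<in>F. \<theta> (snd (I i)) - \<theta> (fst (I i))) \<le> \<theta> B - \<theta> A"
proof -
  let ?J = "\<lambda>i. {\<theta> (fst (I i))<..<\<theta> (snd (I i))}"
  have le: "\<theta> (fst (I i)) \<le> \<theta> (snd (I i))" if "i \<in> F" for i
    using I(1)[OF that] by (intro mono) auto
  have J: "disjoint_family_on ?J F"
    unfolding disjoint_family_on_def
  proof (intro ballI impI)
    fix i j assume ij: "i \<in> F" "j \<in> F" "i \<noteq> j"
    have "{fst (I i)<..<snd (I i)} \<inter> {fst (I j)<..<snd (I j)} = {}"
      using disj ij by (auto simp: disjoint_family_on_def)
    then have "snd (I i) \<le> fst (I j) \<or> snd (I j) \<le> fst (I i)"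
      using I(1)[OF ij(1)] I(1)[OF ij(2)] unfolding Int_greaterThanLessThan greaterThanLessThan_empty_iff by linarith
    then have "\<theta> (snd (I i)) \<le> \<theta> (fst (I j)) \<or> \<theta> (snd (I j)) \<le> \<theta> (fst (I i))"
      using mono by blast
    then show "?J i \<inter> ?J j = {}" by auto
  qed
  have "(\<Sum>i\<in>F. \<theta> (snd (I i)) - \<theta> (fst (I i))) = (\<Sum>i\<in>F. measure lborel (?J i))"
    using le by simp
  also have "\<dots> = measure lborel (\<Union>i\<in>F. ?J i)"
    using J assms(1) le by (intro measure_finite_Union[symmetric]) (auto simp: )
  also have "\<dots> \<le> measure lborel {\<theta> A..\<theta> B}"
  proof (rule measure_mono_fmeasurable)
    show "(\<Union>i\<in>F. ?J i) \<subseteq> {\<theta> A..\<theta> B}"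
    proof
      fix z assume "z \<in> (\<Union>i\<in>F. ?J i)"
      then obtain i where "i \<in> F" "\<theta> (fst (I i)) < z" "z < \<theta> (snd (I i))" by auto
      moreover have "\<theta> A \<le> \<theta> (fst (I i))" "\<theta> (snd (I i)) \<le> \<theta> B"
        using I(1)[OF \<open>i \<in> F\<close>] by (auto intro: mono)
      ultimately show "z \<in> {\<theta> A..\<theta> B}" by simp
    qed
    show "(\<Union>i\<in>F. ?J i) \<in> sets lborel"
      using assms(1) by (intro sets.finite_UN) auto
    show "{\<theta> A..\<theta> B} \<in> fmeasurable lborel"
      using mono[OF I(2)] by (auto simp: fmeasurable_def)
  qed
  also have "\<dots> = \<theta> B - \<theta> A" using mono[OF I(2)] by simp
  finally show ?thesis .
qed

lemma abs_sin_diff_le: "\<bar>sin x - sin y\<bar> \<le> \<bar>x - y\<bar>" for x y :: real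
proof -
  have "\<bar>sin x - sin y\<bar> = 2 * \<bar>sin ((x - y) / 2)\<bar> * \<bar>cos ((x + y) / 2)\<bar>"
    by (simp add: sin_diff_sin abs_mult)
  also have "\<dots> \<le> 2 * \<bar>(x - y) / 2\<bar> * 1"
    by (intro mult_mono abs_sin_x_le_abs_x) auto
  finally show ?thesis by simp
qed

text \<open>The sine is 1-Lipschitz, so the variation is at most the frequency times that of the
  clamped triangle wave, which traverses \<open>[a, b]\<close> once up and once down.\<close>

lemma wave_block_increments:
  assumes I: "(K, I) \<in> interval_collections" "finite F" "F \<subseteq> K" and a: "0 \<le> a" "a \<le> b" "b \<le> pi"
  shows "(\<Sum>i\<in>F. \<bar>wave_block N a b (snd (I i)) - wave_block N a b (fst (I i))\<bar>)
    \<le> 2 * (real N + 1 / 2) * (b - a)"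
proof -
  define w where "w = real N + 1 / 2"
  have w: "0 \<le> w" by (simp add: w_def)
  \<comment> \<open>On \<open>[0, 2\<pi>]\<close> the clamped triangle wave is a difference of two monotone functions.\<close>
  define \<theta>1 where "\<theta>1 x = max a (min b x)" for x
  define \<theta>2 where "\<theta>2 x = max (2 * pi - b) (min (2 * pi - a) x)" for x
  have m1: "\<theta>1 x \<le> \<theta>1 y" and m2: "\<theta>2 x \<le> \<theta>2 y" if "x \<le> y" for x y
    using that by (auto simp: \<theta>1_def \<theta>2_def)
  have IF: "0 \<le> fst (I i) \<and> fst (I i) < snd (I i) \<and> snd (I i) \<le> 2 * pi" if "i \<in> F" for i
    using I that by (auto simp: interval_collections_def)
  have disj: "disjoint_family_on (\<lambda>i. {fst (I i)<..<snd (I i)}) F"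
    using I by (auto simp: interval_collections_def intro: disjoint_family_on_mono)
  \<comment> \<open>Since \<open>b \<le> \<pi>\<close>, on the left half of the period
    \<open>\<theta>2\<close> rests at \<open>2 * \<pi> - b\<close> and on the right half
    \<open>\<theta>1\<close> rests at \<open>b\<close>; the added constant corrects for
    both.\<close>
  have eq: "wave_block N a b x = sin (w * (\<theta>1 x - \<theta>2 x + (2 * pi - b)))" if "x \<in> {0..2*pi}" for x
    unfolding wave_block_def w_def arccos_cos_folded[OF that] \<theta>1_def \<theta>2_def
    using that a by (intro arg_cong[of _ _ sin] arg_cong2[of _ _ _ _ "(*)"] refl) (auto simp: max_def min_def)
  have le: "\<bar>wave_block N a b (snd (I i)) - wave_block N a b (fst (I i))\<bar>
     \<le> w * ((\<theta>1 (snd (I i)) - \<theta>1 (fst (I i))) + (\<theta>2 (snd (I i)) - \<theta>2 (fst (I i))))" if "i \<in> F" for i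
  proof -
    let ?c = "fst (I i)" and ?d = "snd (I i)"
    have "\<bar>wave_block N a b ?d - wave_block N a b ?c\<bar> \<le>
        \<bar>w * (\<theta>1 ?d - \<theta>2 ?d + (2 * pi - b)) - w * (\<theta>1 ?c - \<theta>2 ?c + (2 * pi - b))\<bar>"
      using IF[OF that] by (subst (1 2) eq) (auto intro: abs_sin_diff_le)
    also have "\<dots> = w * \<bar>(\<theta>1 ?d - \<theta>1 ?c) - (\<theta>2 ?d - \<theta>2 ?c)\<bar>"
      unfolding right_diff_distrib[symmetric] abs_mult using w by (simp add: algebra_simps)
    also have "\<dots> \<le> w * ((\<theta>1 ?d - \<theta>1 ?c) + (\<theta>2 ?d - \<theta>2 ?c))"
      using m1[of ?c ?d] m2[of ?c ?d] IF[OF that] w by (intro mult_left_mono) auto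
    finally show ?thesis .
  qed
  have "(\<Sum>i\<in>F. \<bar>wave_block N a b (snd (I i)) - wave_block N a b (fst (I i))\<bar>)
     \<le> (\<Sum>i\<in>F. w * ((\<theta>1 (snd (I i)) - \<theta>1 (fst (I i))) + (\<theta>2 (snd (I i)) - \<theta>2 (fst (I i)))))"
    by (intro sum_mono le)
  also have "\<dots> = w * ((\<Sum>i\<in>F. \<theta>1 (snd (I i)) - \<theta>1 (fst (I i))) + (\<Sum>i\<in>F. \<theta>2 (snd (I i)) - \<theta>2 (fst (I i))))"
    by (simp only: sum_distrib_left[symmetric] sum.distrib)
  also have "\<dots> \<le> w * ((\<theta>1 (2*pi) - \<theta>1 0) + (\<theta>2 (2*pi) - \<theta>2 0))"
    using w by (intro mult_left_mono add_mono sum_mono_increments_le[OF I(2)] m1 m2 IF disj) auto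
  also have "\<theta>1 (2*pi) - \<theta>1 0 = b - a" using a pi_gt_zero by (auto simp: \<theta>1_def max_def min_def)
  also have "\<theta>2 (2*pi) - \<theta>2 0 = b - a" using a pi_gt_zero by (auto simp: \<theta>2_def max_def min_def)
  finally show ?thesis by (simp add: w_def algebra_simps)
qed

text \<open>The weights \<open>i * \<gamma> i\<close> need not be monotone, so no rearrangement: split at \<open>n\<close> instead.\<close>

lemma weighted_sum_le:
  fixes \<gamma> v :: "nat \<Rightarrow> real"
  assumes "finite F" "F \<subseteq> {1..}" "1 \<le> n"
    and pos: "\<And>n. n \<ge> 1 \<Longrightarrow> \<gamma> n > 0" and dec: "\<And>m n. 1 \<le> m \<Longrightarrow> m \<le> n \<Longrightarrow> \<gamma> n \<le> \<gamma> m"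
    and v: "\<And>i. i \<in> F \<Longrightarrow> 0 \<le> v i" "\<And>i. i \<in> F \<Longrightarrow> v i \<le> 2" and V: "(\<Sum>i\<in>F. v i) \<le> V"
    and M: "0 < M" "\<And>i. n < i \<Longrightarrow> M \<le> real i * \<gamma> i"
  shows "(\<Sum>i\<in>F. v i / (real i * \<gamma> i)) \<le> 2 * harm n / \<gamma> n + V / M"
proof -
  let ?t = "\<lambda>i. v i / (real i * \<gamma> i)"
  have F: "F = (F \<inter> {1..n}) \<union> (F \<inter> {n<..})" using assms(2) by auto
  have "sum ?t F = sum ?t (F \<inter> {1..n}) + sum ?t (F \<inter> {n<..})"
    by (subst F, rule sum.union_disjoint) (use assms(1) in auto)
  \<comment> \<open>In the head each increment is at most 2 and \<open>\<gamma> i\<close> is at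
    least \<open>\<gamma> n\<close>, which leaves a harmonic sum. In the tail the weights are at
    least \<open>M\<close> and the total variation takes over.\<close>
  also have "sum ?t (F \<inter> {1..n}) \<le> (\<Sum>i\<in>F \<inter> {1..n}. 2 / \<gamma> n * inverse (real i))"
  proof (rule sum_mono)
    fix i assume i: "i \<in> F \<inter> {1..n}"
    then have "?t i \<le> 2 / (real i * \<gamma> n)"
      using v[of i] pos[of n] dec[of i n] \<open>1 \<le> n\<close> by (intro frac_le mult_left_mono) auto
    then show "?t i \<le> 2 / \<gamma> n * inverse (real i)" by (simp add: field_simps)
  qed
  also have "\<dots> \<le> (\<Sum>i\<in>{1..n}. 2 / \<gamma> n * inverse (real i))"
    using pos[OF \<open>1 \<le> n\<close>] by (intro sum_mono2) auto
  also have "\<dots> = 2 * harm n / \<gamma> n"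
    unfolding harm_def sum_distrib_left[symmetric] by simp
  also have "sum ?t (F \<inter> {n<..}) \<le> (\<Sum>i\<in>F \<inter> {n<..}. v i / M)"
    using v M by (intro sum_mono frac_le) auto
  also have "\<dots> \<le> (\<Sum>i\<in>F. v i / M)"
    using v M assms(1) by (intro sum_mono2) auto
  also have "\<dots> \<le> V / M"
    using V M by (simp add: divide_right_mono flip: sum_divide_distrib)
  finally show ?thesis by simp
qed

subsection \<open>Blocks on which the sequence is almost constant\<close>

lemma harm_le_1_plus_ln:
  assumes "1 \<le> n"
  shows "harm n \<le> 1 + ln (real n)"
proof -
  obtain m where n: "n = Suc m" using assms by (cases n) auto
  have "harm (Suc m) - ln (real (Suc m)) \<le> harm (Suc 0) - ln (real (Suc 0))"
    by (rule decseqD[OF decseq_harm_diff_ln]) simp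
  then show ?thesis by (simp add: n harm_def)
qed

lemma half_le_ln:
  assumes "2 \<le> (n::nat)"
  shows "1 / 2 \<le> ln (real n)"
proof -
  have "2 / 3 \<le> ln (2::real)" by (rule ln2_ge_two_thirds)
  also have "\<dots> \<le> ln (real n)" using assms by simp
  finally show ?thesis by simp
qed

text \<open>One constant \<open>C\<close> serves both as the loss of \<open>\<gamma>\<close> over a
  block and as the least growth of \<open>q\<close>, so the growth compensates the loss.
  \<open>C\<close> is at least 3, which exceeds e, so that every block has logarithmic length at
  least 1.\<close>

locale slow_blocks =
  fixes \<gamma> :: "nat \<Rightarrow> real" and \<delta> C :: real and q :: "nat \<Rightarrow> nat"
  assumes pos: "\<And>n. n \<ge> 1 \<Longrightarrow> \<gamma> n > 0"
    and dec: "\<And>m n. 1 \<le> m \<Longrightarrow> m \<le> n \<Longrightarrow> \<gamma> n \<le> \<gamma> m"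
    and \<delta>: "\<delta> > 0"
    and C: "3 \<le> C"
    and q_ge: "\<And>k. 2 \<le> q k"
    and q_Suc: "\<And>k. C * real (q k) \<le> real (q (Suc k))"
    and \<gamma>_q: "\<And>k. \<gamma> (q k) \<le> C * \<gamma> (q (Suc k))"
    and ln_q_le: "\<And>k. ln (real (q (Suc k))) \<le> (1 + \<delta>) * ln (real (q k))"
    and ln_q_ge: "\<And>k. \<delta> / 2 * ln (real (q k)) \<le> ln (real (q (Suc k)) / real (q k))"
    and diverges: "\<not> summable (\<lambda>n. \<gamma> (n + 1) / real (n + 1))"
begin

lemma q_less: "q k < q (Suc k)"
proof -
  have "3 * real (q k) \<le> C * real (q k)" using C by (intro mult_right_mono) auto
  also have "\<dots> \<le> real (q (Suc k))" by (rule q_Suc)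
  finally show ?thesis using q_ge[of k] by linarith
qed

lemma strict_mono_q: "strict_mono q"
  using q_less by (simp add: strict_mono_Suc_iff)

lemma q_mono: "k \<le> l \<Longrightarrow> q k \<le> q l"
  using strict_mono_q by (simp add: strict_mono_less_eq)

lemma ln_q_pos: "1 / 2 \<le> ln (real (q k))"
  by (rule half_le_ln[OF q_ge])

lemma \<gamma>_q_pos: "0 < \<gamma> (q k)"
  using q_ge[of k] by (intro pos) simp

lemma ln_q_ratio_ge_1: "1 \<le> ln (real (q (Suc k)) / real (q k))"
proof -
  have q0: "0 < real (q k)" using q_ge[of k] by simp
  have "exp 1 \<le> (3::real)" using exp_le by simp
  also have "\<dots> \<le> real (q (Suc k)) / real (q k)"
    using C q_Suc[of k] q0 by (simp add: le_divide_eq) (meson mult_right_mono of_nat_0_le_iff order_trans)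
  finally show ?thesis
    using q0 q_ge[of "Suc k"] by (subst ln_ge_iff) auto
qed

lemma q_times_\<gamma>_mono: "k \<le> l \<Longrightarrow> real (q k) * \<gamma> (q k) \<le> real (q l) * \<gamma> (q l)"
proof (induction l rule: dec_induct)
  case (step l)
  have "real (q l) * \<gamma> (q l) \<le> real (q l) * (C * \<gamma> (q (Suc l)))"
    by (intro mult_left_mono \<gamma>_q) auto
  also have "\<dots> = (C * real (q l)) * \<gamma> (q (Suc l))" by simp
  also have "\<dots> \<le> real (q (Suc l)) * \<gamma> (q (Suc l))"
    using \<gamma>_q_pos[of "Suc l"] by (intro mult_right_mono q_Suc) auto
  finally show ?case using step.IH by simp
qed simp

text \<open>Substitute for monotone weights: \<open>i\<close> lies in some block from
  \<open>q l\<close> to \<open>q (Suc l)\<close> with \<open>l \<ge> k\<close>, where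
  \<open>\<gamma>\<close> loses at most the factor \<open>C\<close>, and the weights at the block
  ends increase.\<close>

lemma weight_quasi_mono:
  assumes "q k \<le> i"
  shows "real (q k) * \<gamma> (q k) \<le> C * (real i * \<gamma> i)"
proof -
  have "\<exists>j. q j > i"
    using strict_mono_q by (metis Suc_le_eq strict_mono_imp_increasing)
  \<comment> \<open>The first block end beyond \<open>i\<close>; with \<open>j = Suc l\<close> this
    gives \<open>q l \<le> i < q (Suc l)\<close>.\<close>
  define j where "j = (LEAST j. q j > i)"
  have j: "q j > i" unfolding j_def by (rule LeastI_ex) fact
  have below: "q l \<le> i" if "l < j" for l
    using not_less_Least[OF that[unfolded j_def]] by simp
  have "k < j" using j assms q_mono[of j k] by (cases "k < j") auto
  then obtain l where l: "j = Suc l" "k \<le> l" by (cases j) auto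
  have ql: "q l \<le> i" using below[of l] l by simp
  have i: "1 \<le> i" using ql q_ge[of l] by simp
  have "real (q k) * \<gamma> (q k) \<le> real (q l) * \<gamma> (q l)" by (rule q_times_\<gamma>_mono[OF l(2)])
  also have "\<dots> \<le> real (q l) * (C * \<gamma> (q (Suc l)))" by (intro mult_left_mono \<gamma>_q) auto
  also have "\<dots> \<le> real i * (C * \<gamma> i)"
    using ql C dec[of i "q (Suc l)"] j l(1) i \<gamma>_q_pos[of "Suc l"] by (intro mult_mono) auto
  finally show ?thesis by (simp add: mult_ac)
qed

text \<open>Up to a constant, the reciprocal of the \<Lambda>-variation bound of the
  \<open>k\<close>-th wave. Against the squared kernel integral, of order at least
  \<open>ln\<^sup>2 (q k)\<close>, it leaves \<open>\<gamma> (q k) * ln (q k)\<close>.\<close>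

definition amp :: "nat \<Rightarrow> real" where "amp k = \<gamma> (q k) / ln (real (q k))"

lemma amp_pos: "0 < amp k"
  unfolding amp_def using \<gamma>_q_pos[of k] ln_q_pos[of k] by (intro divide_pos_pos) auto

lemma amp_le: "amp k \<le> amp 0"
  unfolding amp_def using \<gamma>_q_pos[of k] ln_q_pos[of 0] dec[of "q 0" "q k"] q_ge[of 0] q_mono[of 0 k]
  by (intro frac_le) auto

text \<open>A block contributes at most a constant times \<open>\<gamma> (q k) * ln (q k)\<close> to
  the given series, because \<open>\<gamma>\<close> decreases and \<open>ln (q k)\<close> grows by a
  bounded factor. Bounded block sums would make that series converge.\<close>

lemma block_sum_unbounded: "\<exists>K. R < (\<Sum>k<K. \<gamma> (q k) * ln (real (q k)))"
proof (rule ccontr)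
  assume "\<not> ?thesis"
  then have R: "(\<Sum>k<K. \<gamma> (q k) * ln (real (q k))) \<le> R" for K by (auto simp: not_less)
  \<comment> \<open>The harmonic sum is at most \<open>1 + ln (q (Suc k))\<close>; here
    \<open>1 \<le> 2 * ln (q k)\<close> accounts for 2 and the block ratio of logarithms for
    \<open>1 + \<delta>\<close>. \<open>A\<close> is the part before the first block.\<close>
  define D where "D = 3 + \<delta>"
  define A where "A = (\<Sum>n\<in>{1..<q 0}. \<gamma> n / real n)"
  have blk: "(\<Sum>n\<in>{q k..<q (Suc k)}. \<gamma> n / real n) \<le> D * (\<gamma> (q k) * ln (real (q k)))" for k
  proof -
    have "(\<Sum>n\<in>{q k..<q (Suc k)}. \<gamma> n / real n) \<le> (\<Sum>n\<in>{q k..<q (Suc k)}. \<gamma> (q k) * inverse (real n))"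
      using q_ge[of k] by (intro sum_mono) (auto simp: divide_inverse intro!: mult_right_mono dec)
    also have "\<dots> \<le> (\<Sum>n\<in>{1..q (Suc k)}. \<gamma> (q k) * inverse (real n))"
      using q_ge[of k] \<gamma>_q_pos[of k] by (intro sum_mono2) auto
    also have "\<dots> = \<gamma> (q k) * harm (q (Suc k))"
      unfolding harm_def sum_distrib_left ..
    also have "\<dots> \<le> \<gamma> (q k) * (D * ln (real (q k)))"
    proof (intro mult_left_mono)
      have "harm (q (Suc k)) \<le> 1 + ln (real (q (Suc k)))"
        using q_ge[of "Suc k"] by (intro harm_le_1_plus_ln) simp
      also have "\<dots> \<le> 2 * ln (real (q k)) + (1 + \<delta>) * ln (real (q k))"
        using ln_q_pos[of k] ln_q_le[of k] by linarith
      finally show "harm (q (Suc k)) \<le> D * ln (real (q k))" by (simp add: D_def algebra_simps)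
    qed (use \<gamma>_q_pos[of k] in simp)
    finally show ?thesis by (simp add: mult_ac)
  qed
  have upto: "(\<Sum>n\<in>{1..<q K}. \<gamma> n / real n) \<le> A + D * (\<Sum>k<K. \<gamma> (q k) * ln (real (q k)))" for K
  proof (induction K)
    case (Suc K)
    have "(\<Sum>n\<in>{1..<q (Suc K)}. \<gamma> n / real n) =
       (\<Sum>n\<in>{1..<q K}. \<gamma> n / real n) + (\<Sum>n\<in>{q K..<q (Suc K)}. \<gamma> n / real n)"
      using q_ge[of K] q_less[of K] by (intro sum.atLeastLessThan_concat[symmetric]) auto
    then show ?case using Suc blk[of K] by (simp add: algebra_simps)
  qed (simp add: A_def)
  have "summable (\<lambda>n. \<gamma> (n + 1) / real (n + 1))"
  proof (rule summableI_nonneg_bounded)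
    show "0 \<le> \<gamma> (n + 1) / real (n + 1)" for n using pos[of "n + 1"] by simp
    fix M
    have M: "M + 1 \<le> q (M + 1)" using strict_mono_q by (rule strict_mono_imp_increasing)
    have "(\<Sum>n<M. \<gamma> (n + 1) / real (n + 1)) = (\<Sum>n\<in>{1..<M + 1}. \<gamma> n / real n)"
      by (rule sum.reindex_bij_witness[of _ "\<lambda>n. n - 1" "\<lambda>n. n + 1"]) auto
    also have "\<dots> \<le> (\<Sum>n\<in>{1..<q (M + 1)}. \<gamma> n / real n)"
      using M by (intro sum_mono2) (auto intro!: divide_nonneg_nonneg less_imp_le[OF pos])
    also have "\<dots> \<le> A + D * R"
    proof -
      have "D * (\<Sum>k<M + 1. \<gamma> (q k) * ln (real (q k))) \<le> D * R"
        using \<delta> by (intro mult_left_mono R) (simp add: D_def)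
      then show ?thesis using upto[of "M + 1"] by linarith
    qed
    finally show "(\<Sum>n<M. \<gamma> (n + 1) / real (n + 1)) \<le> A + D * R" .
  qed
  with diverges show False by simp
qed

end

text \<open>Iterate \<open>n \<mapsto> [n powr (1 + \<delta>)]\<close> from a point beyond which all
  asymptotic hypotheses hold as inequalities.\<close>

lemma slow_blocks_exist:
  fixes \<gamma> :: "nat \<Rightarrow> real"
  assumes pos: "\<And>n. n \<ge> 1 \<Longrightarrow> \<gamma> n > 0"
    and dec: "\<And>n. n \<ge> 1 \<Longrightarrow> \<gamma> n \<ge> \<gamma> (n + 1)"
    and \<delta>: "\<delta> > 0"
    and O: "\<gamma> \<in> O(\<lambda>n. \<gamma> (nat \<lfloor>real n powr (1 + \<delta>)\<rfloor>))"
    and div: "\<not> summable (\<lambda>n. \<gamma> (n + 1) / real (n + 1))"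
  obtains C q where "slow_blocks \<gamma> \<delta> C q"
proof -
  define \<phi> where "\<phi> n = nat \<lfloor>real n powr (1 + \<delta>)\<rfloor>" for n
  obtain c where c: "\<forall>\<^sub>F n in sequentially. norm (\<gamma> n) \<le> c * norm (\<gamma> (\<phi> n))"
    using O unfolding \<phi>_def by (elim landau_o.bigE)
  define C where "C = max 3 c"
  have "\<forall>\<^sub>F n in sequentially. C \<le> real n powr (\<delta> / 2)"
    using \<delta> by real_asymp
  \<comment> \<open>Half of the gain in the exponent is given up to absorb the rounding; this is the
    origin of \<open>\<delta> / 2\<close> in the lower bound on block lengths.\<close>
  moreover have "\<forall>\<^sub>F n in sequentially. real n powr (1 + \<delta> / 2) \<le> real n powr (1 + \<delta>) - 1"
    using \<delta> by real_asymp
  ultimately have "\<forall>\<^sub>F n in sequentially. norm (\<gamma> n) \<le> c * norm (\<gamma> (\<phi> n)) \<and> C \<le> real n powr (\<delta> / 2) \<and>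
     real n powr (1 + \<delta> / 2) \<le> real n powr (1 + \<delta>) - 1"
    using c by eventually_elim auto
  then obtain n1 where n1: "\<And>n. n1 \<le> n \<Longrightarrow> norm (\<gamma> n) \<le> c * norm (\<gamma> (\<phi> n))"
    "\<And>n. n1 \<le> n \<Longrightarrow> C \<le> real n powr (\<delta> / 2)"
    "\<And>n. n1 \<le> n \<Longrightarrow> real n powr (1 + \<delta> / 2) \<le> real n powr (1 + \<delta>) - 1"
    unfolding eventually_sequentially by blast
  \<comment> \<open>Starting at 2 or later keeps \<open>ln (q k)\<close> away from 0, so it can be
    divided by and can absorb constants.\<close>
  define n0 where "n0 = max 2 n1"
  have lower: "real n * real n powr (\<delta> / 2) \<le> real (\<phi> n)" and upper: "real (\<phi> n) \<le> real n powr (1 + \<delta>)"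
    if n: "n0 \<le> n" for n
  proof -
    have "real n * real n powr (\<delta> / 2) = real n powr (1 + \<delta> / 2)"
      using n by (simp add: powr_add n0_def)
    also have "\<dots> \<le> real n powr (1 + \<delta>) - 1" using n1(3)[of n] n by (simp add: n0_def)
    also have "\<dots> \<le> real (\<phi> n)" unfolding \<phi>_def by linarith
    finally show "real n * real n powr (\<delta> / 2) \<le> real (\<phi> n)" .
    show "real (\<phi> n) \<le> real n powr (1 + \<delta>)"
      unfolding \<phi>_def by simp
  qed
  have C\<phi>: "C * real n \<le> real (\<phi> n)" if "n0 \<le> n" for n
  proof -
    have "C * real n \<le> real n powr (\<delta> / 2) * real n"
      using n1(2)[of n] that by (intro mult_right_mono) (auto simp: n0_def)
    then show ?thesis using lower[OF that] by (simp add: mult.commute)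
  qed
  have \<phi>_ge: "n \<le> \<phi> n" if "n0 \<le> n" for n
  proof -
    have "1 * real n \<le> C * real n" by (intro mult_right_mono) (auto simp: C_def)
    then show ?thesis using C\<phi>[OF that] by simp
  qed
  define q where "q k = (\<phi> ^^ k) n0" for k
  have qS: "q (Suc k) = \<phi> (q k)" for k by (simp add: q_def)
  have qn0: "n0 \<le> q k" for k
  proof (induction k)
    case (Suc k)
    then show ?case using \<phi>_ge[of "q k"] by (simp add: qS)
  qed (simp add: q_def)
  have q2: "2 \<le> q k" for k using qn0[of k] by (simp add: n0_def)
  have pos_q: "0 < \<gamma> (q k)" for k using q2[of k] by (intro pos) simp
  have "slow_blocks \<gamma> \<delta> C q"
  proof
    show "\<gamma> n \<le> \<gamma> m" if "1 \<le> m" "m \<le> n" for m n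
      using that(2,1) by (induction n rule: dec_induct) (auto intro: order_trans[OF dec[simplified]])
    show "\<gamma> (q k) \<le> C * \<gamma> (q (Suc k))" for k
    proof -
      have "\<gamma> (q k) \<le> c * \<gamma> (q (Suc k))"
        using n1(1)[of "q k"] qn0[of k] pos_q[of k] pos_q[of "Suc k"] by (simp add: n0_def qS)
      also have "\<dots> \<le> C * \<gamma> (q (Suc k))"
        using pos_q[of "Suc k"] by (intro mult_right_mono) (auto simp: C_def)
      finally show ?thesis .
    qed
    show "ln (real (q (Suc k))) \<le> (1 + \<delta>) * ln (real (q k))" for k
    proof -
      have "ln (real (q (Suc k))) \<le> ln (real (q k) powr (1 + \<delta>))"
        using upper[OF qn0[of k]] q2[of "Suc k"] q2[of k] by (subst ln_le_cancel_iff) (auto simp: qS)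
      then show ?thesis by simp
    qed
    show "\<delta> / 2 * ln (real (q k)) \<le> ln (real (q (Suc k)) / real (q k))" for k
    proof -
      have "real (q k) powr (\<delta> / 2) \<le> real (q (Suc k)) / real (q k)"
        using lower[OF qn0[of k]] q2[of k] by (simp add: qS field_simps)
      then have "ln (real (q k) powr (\<delta> / 2)) \<le> ln (real (q (Suc k)) / real (q k))"
        using q2[of k] q2[of "Suc k"] by (subst ln_le_cancel_iff) auto
      then show ?thesis by simp
    qed
    show "C * real (q k) \<le> real (q (Suc k))" for k
      using C\<phi>[OF qn0[of k]] by (simp add: qS)
  qed (use pos \<delta> q2 div in \<open>auto simp: C_def\<close>)
  then show thesis by (rule that)
qed

subsection \<open>The test functions\<close>

context slow_blocks
begin

text \<open>The \<open>q k\<close>-th positive zero of the sine of frequency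
  \<open>q K + 1/2\<close>. Cutting at zeros keeps the blocks continuous, and up to
  \<open>k = K\<close> the nodes stay within \<open>[0, \<pi>]\<close>.\<close>

definition node :: "nat \<Rightarrow> nat \<Rightarrow> real" where
  "node K k = real (q k) * pi / (real (q K) + 1 / 2)"

definition wave :: "nat \<Rightarrow> nat \<Rightarrow> real \<Rightarrow> real" where
  "wave K k = wave_block (q K) (node K k) (node K (Suc k))"

lemma freq_node: "(real (q K) + 1 / 2) * node K k = real (q k) * pi"
  by (simp add: node_def add_pos_nonneg pos_add_strict)

lemma sin_node: "sin ((real (q K) + 1 / 2) * node K k) = 0"
  unfolding freq_node by simp

lemma node_pos: "0 < node K k"
  unfolding node_def using q_ge[of k] by (intro divide_pos_pos mult_pos_pos) auto

lemma node_mono: "k \<le> l \<Longrightarrow> node K k \<le> node K l"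
  unfolding node_def using q_mono[of k l] by (intro divide_right_mono mult_right_mono) auto

lemma node_le_pi: "k \<le> K \<Longrightarrow> node K k \<le> pi"
  using q_mono[of k K] by (simp add: node_def divide_le_eq mult.commute)

text \<open>With \<open>L\<close> the logarithm of the block ratio, the error is at most 1/4 and
  \<open>L \<ge> 1\<close>, so \<open>L / 2 - 1 / 4 \<ge> L / 4\<close>, which is at least
  \<open>\<delta> / 8 * ln (q k)\<close>.\<close>

lemma wave_integral_ge:
  assumes "k < K"
  shows "\<delta> / 8 * ln (real (q k)) \<le> integral {0..2*pi} (\<lambda>x. wave K k x * dirichlet_kernel (q K) x)"
proof -
  let ?L = "ln (real (q (Suc k)) / real (q k))"
  have ratio: "node K (Suc k) / node K k = real (q (Suc k)) / real (q k)"
    by (simp add: node_def add_nonneg_eq_0_iff)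
  have "4 * (real (q K) + 1 / 2) * node K k = 4 * (real (q k) * pi)"
    unfolding freq_node[symmetric, of k K] by (simp add: mult.assoc)
  moreover have "4 * (1 * 1) \<le> 4 * (real (q k) * pi)"
    using q_ge[of k] pi_gt3 by (intro mult_left_mono mult_mono) auto
  ultimately have "1 / (4 * (real (q K) + 1 / 2) * node K k) \<le> 1 / 4"
    by (simp only:) (simp add: frac_le divide_le_eq)
  then have "?L / 2 - 1 / 4 \<le> ln (node K (Suc k) / node K k) / 2 - 1 / (4 * (real (q K) + 1 / 2) * node K k)"
    unfolding ratio by simp
  also have "\<dots> \<le> integral {0..2*pi} (\<lambda>x. wave K k x * dirichlet_kernel (q K) x)"
    unfolding wave_def using assms
    by (intro wave_block_integral_ge node_pos node_mono node_le_pi sin_node) auto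
  finally show ?thesis using ln_q_ratio_ge_1[of k] ln_q_ge[of k] by linarith
qed

text \<open>The waves live on successive node intervals, so at each point at most one is nonzero.
  This keeps the sup norm and the variation of the sections from accumulating with
  \<open>K\<close>.\<close>

lemma wave_sum_le_1: "(\<Sum>k<K. \<bar>wave K k x\<bar>) \<le> 1"
proof (cases "\<exists>k0<K. wave K k0 x \<noteq> 0")
  case True
  then obtain k0 where k0: "k0 < K" "wave K k0 x \<noteq> 0" by blast
  have supp: "arccos (cos x) \<in> {node K k<..<node K (Suc k)}" if "wave K k x \<noteq> 0" for k
    using that wave_block_eq_0[OF node_mono[of k "Suc k"] sin_node sin_node] unfolding wave_def by auto
  have "wave K k x = 0" if "k \<noteq> k0" for k
  proof (rule ccontr)
    assume "wave K k x \<noteq> 0"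
    with supp[OF this] supp[OF k0(2)] have "node K k0 < node K (Suc k)" "node K k < node K (Suc k0)"
      by auto
    then show False using that node_mono[of "Suc k" k0 K] node_mono[of "Suc k0" k K] by linarith
  qed
  then have "(\<Sum>k<K. \<bar>wave K k x\<bar>) = (\<Sum>k\<in>{k0}. \<bar>wave K k x\<bar>)"
    using k0(1) by (intro sum.mono_neutral_right) auto
  then show ?thesis using abs_wave_block_le_1 by (simp add: wave_def)
qed auto

definition var_bound :: real where "var_bound = (6 + 4 * pi * C) * (1 + \<delta>) * C"

lemma var_bound_nonneg: "0 \<le> var_bound"
  unfolding var_bound_def using C \<delta> by (intro mult_nonneg_nonneg) auto

text \<open>The wave has total variation at most \<open>2 * \<pi> * n\<close> with
  \<open>n = q (Suc k)\<close>. Splitting the weighted sum at \<open>n\<close> gives a harmonic head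
  \<open>2 * harm n / \<gamma> n\<close> and a tail \<open>2 * \<pi> * C / \<gamma> n\<close>, both
  of order \<open>ln n / \<gamma> n\<close>.\<close>

lemma wave_variation:
  assumes I: "(K', I) \<in> interval_collections" "finite F" "F \<subseteq> K'" and k: "k < K"
  shows "amp k * (\<Sum>i\<in>F. \<bar>wave K k (snd (I i)) - wave K k (fst (I i))\<bar> / (real i * \<gamma> i)) \<le> var_bound"
proof -
  define n where "n = q (Suc k)"
  have n2: "2 \<le> n" by (simp add: n_def q_ge)
  have \<gamma>n: "0 < \<gamma> n" by (simp add: n_def \<gamma>_q_pos)
  have F: "F \<subseteq> {1..}" using I by (auto simp: interval_collections_def)
  let ?v = "\<lambda>i. \<bar>wave K k (snd (I i)) - wave K k (fst (I i))\<bar>"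
  have V: "(\<Sum>i\<in>F. ?v i) \<le> 2 * pi * real n"
  proof -
    have "(\<Sum>i\<in>F. ?v i) \<le> 2 * (real (q K) + 1 / 2) * (node K (Suc k) - node K k)"
      unfolding wave_def using k
      by (intro wave_block_increments[OF I] less_imp_le[OF node_pos] node_mono node_le_pi) auto
    also have "\<dots> \<le> 2 * (real (q K) + 1 / 2) * node K (Suc k)"
      using node_pos[of K k] by (intro mult_left_mono) auto
    also have "\<dots> = 2 * pi * real n"
      unfolding mult.assoc freq_node n_def by simp
    finally show ?thesis .
  qed
  have "(\<Sum>i\<in>F. ?v i / (real i * \<gamma> i)) \<le> 2 * harm n / \<gamma> n + 2 * pi * real n / (real n * \<gamma> n / C)"
  proof (rule weighted_sum_le[OF I(2) F _ pos dec _ _ V])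
    show "?v i \<le> 2" for i
      using abs_triangle_ineq4[of "wave K k (snd (I i))" "wave K k (fst (I i))"]
        abs_wave_block_le_1[of "q K" "node K k" "node K (Suc k)"] unfolding wave_def
      by (smt (verit))
    show "0 < real n * \<gamma> n / C" using n2 \<gamma>n C by simp
    show "real n * \<gamma> n / C \<le> real i * \<gamma> i" if "n < i" for i
      using weight_quasi_mono[of "Suc k" i] that C by (simp add: n_def divide_le_eq mult.commute)
  qed (use n2 in auto)
  also have "\<dots> = (2 * harm n + 2 * pi * C) / \<gamma> n"
    using n2 by (simp add: add_divide_distrib)
  also have "\<dots> \<le> (6 + 4 * pi * C) * ln (real n) / \<gamma> n"
  proof (rule divide_right_mono)
    have "harm n \<le> 1 + ln (real n)" using n2 by (intro harm_le_1_plus_ln) simp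
    moreover have h: "1 \<le> 2 * ln (real n)" using half_le_ln[OF n2] by simp
    moreover have "(2 * pi * C) * 1 \<le> (2 * pi * C) * (2 * ln (real n))"
      using h C by (intro mult_left_mono) auto
    ultimately show "2 * harm n + 2 * pi * C \<le> (6 + 4 * pi * C) * ln (real n)"
      unfolding distrib_right by linarith
  qed (use \<gamma>n in simp)
  \<comment> \<open>Passing from \<open>q (Suc k)\<close> back to \<open>q k\<close> costs the
    factor \<open>1 + \<delta>\<close> in the logarithm and \<open>C\<close> in
    \<open>\<gamma>\<close>, the last two factors of \<open>var_bound\<close>.\<close>
  also have "\<dots> \<le> (6 + 4 * pi * C) * ((1 + \<delta>) * ln (real (q k))) / (\<gamma> (q k) / C)"
  proof (rule frac_le)
    show "0 < \<gamma> (q k) / C" using \<gamma>_q_pos[of k] C by simp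
    show "\<gamma> (q k) / C \<le> \<gamma> n" using \<gamma>_q[of k] C by (simp add: n_def divide_le_eq mult.commute)
    show "(6 + 4 * pi * C) * ln (real n) \<le> (6 + 4 * pi * C) * ((1 + \<delta>) * ln (real (q k)))"
      using C ln_q_le[of k] by (intro mult_left_mono) (auto simp: n_def)
    show "0 \<le> (6 + 4 * pi * C) * ((1 + \<delta>) * ln (real (q k)))"
      using C \<delta> ln_q_pos[of k] by (intro mult_nonneg_nonneg) auto
  qed
  also have "\<dots> = var_bound / amp k"
    by (simp add: var_bound_def amp_def mult_ac)
  finally show ?thesis using amp_pos[of k] by (simp add: le_divide_eq mult.commute)
qed

definition tensor_wave :: "nat \<Rightarrow> nat \<Rightarrow> (real \<times> real) \<Rightarrow>\<^sub>C real" where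
  "tensor_wave K k = Bcontfun (\<lambda>p. wave K k (fst p) * wave K k (snd p))"

lemma continuous_on_wave [continuous_intros]: "continuous_on A (wave K k)"
  unfolding wave_def by (rule continuous_on_wave_block)

lemma apply_tensor_wave: "apply_bcontfun (tensor_wave K k) p = wave K k (fst p) * wave K k (snd p)"
proof -
  have c: "continuous_on UNIV (\<lambda>p. wave K k (f p))" if "continuous_on UNIV f" for f :: "real \<times> real \<Rightarrow> real"
    by (rule continuous_on_compose2[OF continuous_on_wave[of UNIV] that]) simp
  have "\<bar>wave K k x * wave K k y\<bar> \<le> 1" for x y
    unfolding abs_mult by (intro mult_le_one) (simp_all add: wave_def abs_wave_block_le_1)
  then have "(\<lambda>p. wave K k (fst p) * wave K k (snd p)) \<in> bcontfun"
    by (intro bcontfun_normI[where b = 1] continuous_on_mult c continuous_on_fst continuous_on_snd continuous_on_id)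
       simp
  then show ?thesis by (simp add: tensor_wave_def Bcontfun_inverse)
qed

definition test_fun :: "nat \<Rightarrow> (real \<times> real) \<Rightarrow>\<^sub>C real" where
  "test_fun K = (\<Sum>k<K. amp k *\<^sub>R tensor_wave K k)"

lemma apply_test_fun: "apply_bcontfun (test_fun K) (x, y) = (\<Sum>k<K. amp k * (wave K k x * wave K k y))"
proof -
  interpret bounded_linear "\<lambda>\<phi> :: (real \<times> real) \<Rightarrow>\<^sub>C real. apply_bcontfun \<phi> (x, y)"
    by (rule bounded_linear_apply_bcontfun)
  show ?thesis by (simp add: test_fun_def sum scaleR apply_tensor_wave)
qed

lemma norm_test_fun_le: "norm (test_fun K) \<le> amp 0"
proof (rule norm_bound)
  fix p :: "real \<times> real"
  obtain x y where p: "p = (x, y)" by fastforce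
  have "\<bar>apply_bcontfun (test_fun K) p\<bar> \<le> (\<Sum>k<K. \<bar>amp k * (wave K k x * wave K k y)\<bar>)"
    unfolding p apply_test_fun by (rule sum_abs)
  also have "\<dots> \<le> (\<Sum>k<K. amp 0 * \<bar>wave K k x\<bar>)"
  proof (rule sum_mono)
    fix k
    have "\<bar>wave K k x * wave K k y\<bar> \<le> \<bar>wave K k x\<bar> * 1"
      unfolding abs_mult by (intro mult_left_mono) (simp_all add: wave_def abs_wave_block_le_1)
    then show "\<bar>amp k * (wave K k x * wave K k y)\<bar> \<le> amp 0 * \<bar>wave K k x\<bar>"
      unfolding abs_mult[of "amp k"] using amp_pos[of k] amp_le[of k] by (intro mult_mono) auto
  qed
  also have "\<dots> \<le> amp 0 * 1"
    unfolding sum_distrib_left[symmetric] using amp_pos[of 0] by (intro mult_left_mono wave_sum_le_1) auto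
  finally show "norm (apply_bcontfun (test_fun K) p) \<le> amp 0" by simp
qed

text \<open>At fixed \<open>y\<close> the section is a combination of waves with coefficients
  \<open>wave K k y\<close>, whose absolute values sum to at most 1, so the bound for a single
  scaled wave survives uniformly in \<open>K\<close>.\<close>

lemma test_fun_variation:
  assumes I: "(K', I) \<in> interval_collections" "finite F" "F \<subseteq> K'"
  shows "(\<Sum>i\<in>F. \<bar>apply_bcontfun (test_fun K) (snd (I i), y) - apply_bcontfun (test_fun K) (fst (I i), y)\<bar> / (real i * \<gamma> i)) \<le> var_bound"
proof -
  let ?d = "\<lambda>k i. \<bar>wave K k (snd (I i)) - wave K k (fst (I i))\<bar> / (real i * \<gamma> i)"
  have wpos: "0 < real i * \<gamma> i" if "i \<in> F" for i
    using that I pos[of i] by (auto simp: interval_collections_def)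
  have "(\<Sum>i\<in>F. \<bar>apply_bcontfun (test_fun K) (snd (I i), y) - apply_bcontfun (test_fun K) (fst (I i), y)\<bar> / (real i * \<gamma> i))
     \<le> (\<Sum>i\<in>F. \<Sum>k<K. \<bar>wave K k y\<bar> * (amp k * ?d k i))"
  proof (rule sum_mono)
    fix i assume i: "i \<in> F"
    have "\<bar>apply_bcontfun (test_fun K) (snd (I i), y) - apply_bcontfun (test_fun K) (fst (I i), y)\<bar> =
       \<bar>\<Sum>k<K. amp k * wave K k y * (wave K k (snd (I i)) - wave K k (fst (I i)))\<bar>"
      by (simp add: apply_test_fun algebra_simps flip: sum_subtractf)
    also have "\<dots> \<le> (\<Sum>k<K. \<bar>amp k * wave K k y * (wave K k (snd (I i)) - wave K k (fst (I i)))\<bar>)"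
      by (rule sum_abs)
    also have "\<dots> = (\<Sum>k<K. \<bar>wave K k y\<bar> * (amp k * \<bar>wave K k (snd (I i)) - wave K k (fst (I i))\<bar>))"
      using amp_pos by (intro sum.cong) (auto simp: abs_mult less_imp_le)
    finally show "\<bar>apply_bcontfun (test_fun K) (snd (I i), y) - apply_bcontfun (test_fun K) (fst (I i), y)\<bar> / (real i * \<gamma> i)
       \<le> (\<Sum>k<K. \<bar>wave K k y\<bar> * (amp k * ?d k i))"
      using divide_right_mono[OF _ less_imp_le[OF wpos[OF i]]] by (fastforce simp: sum_divide_distrib)
  qed
  also have "\<dots> = (\<Sum>k<K. \<bar>wave K k y\<bar> * (amp k * (\<Sum>i\<in>F. ?d k i)))"
    by (subst sum.swap) (simp add: sum_distrib_left)
  also have "\<dots> \<le> (\<Sum>k<K. \<bar>wave K k y\<bar> * var_bound)"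
    by (intro sum_mono mult_left_mono wave_variation[OF I]) auto
  also have "\<dots> \<le> 1 * var_bound"
    unfolding sum_distrib_right[symmetric] by (intro mult_right_mono wave_sum_le_1 var_bound_nonneg)
  finally show ?thesis by simp
qed

definition square_sum :: "nat \<Rightarrow> (real \<times> real) \<Rightarrow>\<^sub>C real \<Rightarrow> complex" where
  "square_sum N \<phi> = fourier_partial_sum N N (\<lambda>x y. apply_bcontfun \<phi> (x, y)) (0, 0)"

lemma bounded_linear_square_sum: "bounded_linear (square_sum N)"
  unfolding square_sum_def by (rule bounded_linear_fourier_partial_sum)

lemma square_sum_test_fun_unbounded: "\<exists>K. R < norm (square_sum (q K) (test_fun K))"
proof -
  \<comment> \<open>The square of the factor \<open>\<delta> / 8\<close> from the kernel integral,
    together with the normalisation of the double Fourier coefficients.\<close>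
  define c where "c = (\<delta> / 8)\<^sup>2 / (4 * pi\<^sup>2)"
  have c: "0 < c" using \<delta> by (simp add: c_def)
  obtain K where K: "R / c < (\<Sum>k<K. \<gamma> (q k) * ln (real (q k)))"
    using block_sum_unbounded by blast
  define J where "J k = integral {0..2*pi} (\<lambda>x. wave K k x * dirichlet_kernel (q K) x)" for k
  interpret bounded_linear "square_sum (q K)" by (rule bounded_linear_square_sum)
  have SE: "square_sum (q K) (tensor_wave K k) = of_real ((J k)\<^sup>2 / (4 * pi\<^sup>2))" for k
    unfolding square_sum_def apply_tensor_wave fst_conv snd_conv J_def
    by (rule fourier_partial_sum_tensor[OF continuous_on_wave])
  have "square_sum (q K) (test_fun K) = (\<Sum>k<K. amp k *\<^sub>R square_sum (q K) (tensor_wave K k))"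
    unfolding test_fun_def by (simp only: sum scaleR)
  also have "\<dots> = of_real (\<Sum>k<K. amp k * ((J k)\<^sup>2 / (4 * pi\<^sup>2)))"
    unfolding SE by (simp add: scaleR_conv_of_real)
  finally have square_sum_eq: "square_sum (q K) (test_fun K) = of_real (\<Sum>k<K. amp k * ((J k)\<^sup>2 / (4 * pi\<^sup>2)))" .
  have "R < c * (\<Sum>k<K. \<gamma> (q k) * ln (real (q k)))"
    using K c by (simp add: divide_less_eq mult.commute)
  also have "\<dots> \<le> (\<Sum>k<K. amp k * ((J k)\<^sup>2 / (4 * pi\<^sup>2)))"
    unfolding sum_distrib_left
  proof (rule sum_mono)
    fix k assume "k \<in> {..<K}"
    then have "\<delta> / 8 * ln (real (q k)) \<le> J k" unfolding J_def by (intro wave_integral_ge) simp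
    moreover have "0 \<le> \<delta> / 8 * ln (real (q k))" using \<delta> ln_q_pos[of k] by simp
    ultimately have "(\<delta> / 8 * ln (real (q k)))\<^sup>2 \<le> (J k)\<^sup>2" by (intro power_mono)
    then have "amp k * ((\<delta> / 8 * ln (real (q k)))\<^sup>2 / (4 * pi\<^sup>2)) \<le> amp k * ((J k)\<^sup>2 / (4 * pi\<^sup>2))"
      using amp_pos[of k] by (intro mult_left_mono divide_right_mono) auto
    also have "amp k * ((\<delta> / 8 * ln (real (q k)))\<^sup>2 / (4 * pi\<^sup>2)) = c * (\<gamma> (q k) * ln (real (q k)))"
      using ln_q_pos[of k] by (simp add: amp_def c_def power2_eq_square)
    finally show "c * (\<gamma> (q k) * ln (real (q k))) \<le> amp k * ((J k)\<^sup>2 / (4 * pi\<^sup>2))" .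
  qed
  also have "\<dots> \<le> norm (square_sum (q K) (test_fun K))"
    unfolding square_sum_eq norm_of_real by (rule abs_ge_self)
  finally show ?thesis by blast
qed

end

section \<open>Passage to the limit function: bounded variation and divergence\<close>

lemma Lambda_V1_le:
  assumes "\<And>y K I F. y \<in> {0..2*pi} \<Longrightarrow> (K, I) \<in> interval_collections \<Longrightarrow> finite F \<Longrightarrow> F \<subseteq> K \<Longrightarrow>
      (\<Sum>i\<in>F. \<bar>incr1 f (I i) y\<bar> / \<Lambda> i) \<le> b"
    and "\<And>i. 1 \<le> i \<Longrightarrow> 0 < \<Lambda> i"
  shows "Lambda_V1 \<Lambda> f \<le> ennreal b"
  unfolding Lambda_V1_def
proof (intro SUP_least, clarify)
  fix y K I assume y: "y \<in> {0..2*pi}" and KI: "(K, I) \<in> interval_collections"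
  have K: "K \<subseteq> {1..}" using KI by (auto simp: interval_collections_def)
  show "(\<Sum>\<^sub>\<infinity>i\<in>K. ennreal (\<bar>incr1 f (I i) y\<bar> / \<Lambda> i)) \<le> ennreal b"
  proof (subst nonneg_infsum_complete; (intro SUP_least)?)
    fix F assume F: "F \<in> {F. finite F \<and> F \<subseteq> K}"
    have "(\<Sum>i\<in>F. ennreal (\<bar>incr1 f (I i) y\<bar> / \<Lambda> i)) = ennreal (\<Sum>i\<in>F. \<bar>incr1 f (I i) y\<bar> / \<Lambda> i)"
      using F K assms(2) by (intro sum_ennreal divide_nonneg_pos) auto
    also have "\<dots> \<le> ennreal b"
      using assms(1)[OF y KI] F by (intro ennreal_leI) auto
    finally show "(\<Sum>i\<in>F. ennreal (\<bar>incr1 f (I i) y\<bar> / \<Lambda> i)) \<le> ennreal b" .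
  qed simp
qed

lemma Lambda_V2_symmetric:
  assumes "\<And>x y. f x y = f y x"
  shows "Lambda_V2 \<Lambda> f = Lambda_V1 \<Lambda> f"
  unfolding Lambda_V1_def Lambda_V2_def incr1_def incr2_def assms[of _ "fst _"] assms[of _ "snd _"] ..

text \<open>Pringsheim convergence does not bound all rectangular sums, but along the diagonal it is
  convergence of an ordinary sequence.\<close>

lemma fourier_converges_at_imp_bounded:
  assumes "fourier_converges_at f p"
  obtains R where "\<And>N. norm (fourier_partial_sum N N f p) \<le> R"
proof -
  obtain L where L: "((\<lambda>(M, N). fourier_partial_sum M N f p) \<longlongrightarrow> L) (sequentially \<times>\<^sub>F sequentially)"
    using assms by (auto simp: fourier_converges_at_def)
  have "filterlim (\<lambda>N. (N, N)) (sequentially \<times>\<^sub>F sequentially) sequentially"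
    by (intro filterlim_Pair filterlim_ident)
  from filterlim_compose[OF L this] have "(\<lambda>N. fourier_partial_sum N N f p) \<longlonglongrightarrow> L" by simp
  then have "Bseq (\<lambda>N. fourier_partial_sum N N f p)" by (intro convergent_imp_Bseq convergentI)
  then show thesis using that by (auto simp: Bseq_def)
qed

theorem theorem6:
  fixes \<gamma> :: "nat \<Rightarrow> real" and \<delta> :: real
  assumes "\<And>n. n \<ge> 1 \<Longrightarrow> \<gamma> n > 0"
    and "\<And>n. n \<ge> 1 \<Longrightarrow> \<gamma> n \<ge> \<gamma> (n + 1)"
    and "\<delta> > 0"
    and "\<gamma> \<in> O(\<lambda>n. \<gamma> (nat \<lfloor>real n powr (1 + \<delta>)\<rfloor>))"
    and "\<not> summable (\<lambda>n. \<gamma> (n + 1) / real (n + 1))"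
  shows "\<exists>f :: real \<Rightarrow> real \<Rightarrow> real.
    continuous_on UNIV (\<lambda>(x, y). f x y) \<and>
    f \<in> PLambdaBV (\<lambda>n. real n * \<gamma> n) \<and>
    \<not> fourier_converges_at f (0, 0)"
proof -
  obtain C q where "slow_blocks \<gamma> \<delta> C q" using slow_blocks_exist[OF assms] .
  then interpret slow_blocks \<gamma> \<delta> C q .
  obtain s m where s: "\<And>k::nat. 0 \<le> (s k :: real)" "summable s"
    and unbdd: "\<And>R. \<exists>n. norm (square_sum (q n) (\<Sum>k. s k *\<^sub>R test_fun (m k))) > R"
    using gliding_hump[of "\<lambda>n. square_sum (q n)" test_fun, OF bounded_linear_square_sum norm_test_fun_le square_sum_test_fun_unbounded] by blast
  define \<Phi> where "\<Phi> = (\<Sum>k. s k *\<^sub>R test_fun (m k))"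
  define f where "f x y = apply_bcontfun \<Phi> (x, y)" for x y
  have sm: "summable (\<lambda>k. s k *\<^sub>R test_fun (m k))"
  proof (rule summable_comparison_test'[OF summable_mult2[OF s(2), of "amp 0"], of 0])
    show "norm (s k *\<^sub>R test_fun (m k)) \<le> s k * amp 0" for k
      using s(1)[of k] norm_test_fun_le[of "m k"] by (simp add: mult_left_mono)
  qed
  have f_sums: "(\<lambda>k. s k * apply_bcontfun (test_fun (m k)) p) sums apply_bcontfun \<Phi> p" for p
    using bounded_linear.sums[OF bounded_linear_apply_bcontfun summable_sums[OF sm], of p]
    by (simp add: \<Phi>_def)
  \<comment> \<open>Pointwise identities shared by all test functions pass to the series; applied to
    symmetry and periodicity.\<close>
  have transfer: "f x y = f x' y'"
    if "\<And>K. apply_bcontfun (test_fun K) (x, y) = apply_bcontfun (test_fun K) (x', y')" for x y x' y'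
    using f_sums[of "(x, y)"] f_sums[of "(x', y')"] unfolding f_def that by (rule sums_unique2)
  have sym: "f x y = f y x" for x y
    by (rule transfer) (simp add: apply_test_fun mult.commute)
  have per: "doubly_periodic f"
    unfolding doubly_periodic_def
    by (intro allI conjI transfer) (simp_all add: apply_test_fun wave_def wave_block_periodic)
  have wpos: "0 < real i * \<gamma> i" if "1 \<le> i" for i using pos[of i] that by simp
  have "Lambda_V1 (\<lambda>n. real n * \<gamma> n) f \<le> ennreal (suminf s * var_bound)"
  proof (rule Lambda_V1_le[OF _ wpos])
    fix y K I F assume KI: "(K, I) \<in> interval_collections" "finite F" "F \<subseteq> (K :: nat set)"
    \<comment> \<open>For a fixed finite subcollection \<open>v\<close> is a seminorm that is
      continuous under pointwise convergence, so the uniform bound passes to the partial sums by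
      subadditivity and then to the limit.\<close>
    define v where "v \<phi> = (\<Sum>i\<in>F. \<bar>\<phi> (snd (I i), y) - \<phi> (fst (I i), y)\<bar> / (real i * \<gamma> i))"
      for \<phi> :: "real \<times> real \<Rightarrow> real"
    have F: "0 < real i * \<gamma> i" if "i \<in> F" for i
      using wpos[of i] KI that by (auto simp: interval_collections_def)
    have v_le: "v (\<lambda>p. \<Sum>k<n. s k * apply_bcontfun (test_fun (m k)) p) \<le> (\<Sum>k<n. s k) * var_bound" for n
    proof (induction n)
      case (Suc n)
      let ?a = "\<lambda>p. \<Sum>k<n. s k * apply_bcontfun (test_fun (m k)) p"
      have "v (\<lambda>p. ?a p + s n * apply_bcontfun (test_fun (m n)) p) \<le> v ?a + s n * v (apply_bcontfun (test_fun (m n)))"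
        unfolding v_def sum_distrib_left sum.distrib[symmetric]
      proof (rule sum_mono)
        fix i assume "i \<in> F"
        let ?d = "\<lambda>\<phi>. \<phi> (snd (I i), y) - \<phi> (fst (I i), y) :: real"
        have "\<bar>?d (\<lambda>p. ?a p + s n * apply_bcontfun (test_fun (m n)) p)\<bar> = \<bar>?d ?a + s n * ?d (apply_bcontfun (test_fun (m n)))\<bar>"
          by (simp add: algebra_simps)
        also have "\<dots> \<le> \<bar>?d ?a\<bar> + s n * \<bar>?d (apply_bcontfun (test_fun (m n)))\<bar>"
          using abs_triangle_ineq[of "?d ?a" "s n * ?d (apply_bcontfun (test_fun (m n)))"] s(1)[of n] by (simp add: abs_mult)
        finally show "\<bar>?d (\<lambda>p. ?a p + s n * apply_bcontfun (test_fun (m n)) p)\<bar> / (real i * \<gamma> i) \<le>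
          \<bar>?d ?a\<bar> / (real i * \<gamma> i) + s n * (\<bar>?d (apply_bcontfun (test_fun (m n)))\<bar> / (real i * \<gamma> i))"
          using divide_right_mono[OF _ less_imp_le[OF F[OF \<open>i \<in> F\<close>]]] by (fastforce simp: add_divide_distrib)
      qed
      also have "\<dots> \<le> (\<Sum>k<n. s k) * var_bound + s n * var_bound"
        using Suc test_fun_variation[OF KI] s(1)[of n] unfolding v_def by (intro add_mono mult_left_mono) auto
      finally show ?case by (simp add: algebra_simps)
    qed (simp add: v_def)
    have "(\<lambda>n. v (\<lambda>p. \<Sum>k<n. s k * apply_bcontfun (test_fun (m k)) p)) \<longlonglongrightarrow> v (apply_bcontfun \<Phi>)"
      unfolding v_def using F
      by (intro tendsto_intros f_sums[unfolded sums_def]) force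
    moreover have "(\<Sum>k<n. s k) * var_bound \<le> suminf s * var_bound" for n
      using s var_bound_nonneg by (intro mult_right_mono sum_le_suminf) auto
    ultimately have "v (apply_bcontfun \<Phi>) \<le> suminf s * var_bound"
      using v_le by (intro LIMSEQ_le_const2) (auto intro: order_trans)
    then show "(\<Sum>i\<in>F. \<bar>incr1 f (I i) y\<bar> / (real i * \<gamma> i)) \<le> suminf s * var_bound"
      by (simp add: v_def incr1_def f_def)
  qed
  then have V1: "Lambda_V1 (\<lambda>n. real n * \<gamma> n) f < \<infinity>"
    by (rule order_le_less_trans) simp
  then have "f \<in> PLambdaBV (\<lambda>n. real n * \<gamma> n)"
    using per by (simp add: PLambdaBV_def Lambda_V2_symmetric[OF sym] less_top)
  moreover have "continuous_on UNIV (\<lambda>(x, y). f x y)"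
    by (simp add: f_def case_prod_beta)
  moreover have "\<not> fourier_converges_at f (0, 0)"
  proof
    assume "fourier_converges_at f (0, 0)"
    then obtain R where R: "\<And>N. norm (fourier_partial_sum N N f (0, 0)) \<le> R"
      by (rule fourier_converges_at_imp_bounded) blast
    obtain n where "R < norm (square_sum (q n) \<Phi>)" using unbdd[of R] by (auto simp: \<Phi>_def)
    moreover have "square_sum (q n) \<Phi> = fourier_partial_sum (q n) (q n) f (0, 0)"
      by (simp add: square_sum_def f_def[abs_def])
    ultimately show False using R[of "q n"] by simp
  qed
  ultimately show ?thesis by blast
qed

end
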